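(* Let $V=[V_{i,j}]\in\mathbb{R}^{n\times p}$ have independent entries, where for each column $j$ the entries $V_{i,j}$ are distributed as $\mathrm{subG}(b_j)$ with variance $\mathbb{E}[V_{i,j}^2]=\sigma_j^2>0$, and let $X=V\,\mathrm{diag}(1/\|V_1\|_2,\dots,1/\|V_p\|_2)$. Let $y=X\beta+\eta$ with $\beta\in\mathbb{R}^p$ a fixed $k$-sparse vector with support $\mathcal{S}$, and $\eta\in\mathbb{R}^n$ independent of $V$ with independent $\mathcal{N}(0,\sigma^2)$ entries. Define $\frac{\sigma_*}{b_*}:=\min_{j\in\mathcal{S}}\frac{\sigma_j}{b_j}$, and assume $\log p\le\frac{n}{16}\big(\frac{\sigma_*}{4b_*}\big)^4$ and $$\frac{\beta_{\min}}{\|\beta\|_2}>2\sqrt{\frac{8\log p}{n}}\Big(\frac{b_*}{\sigma_*}\Big)+\frac{4\sqrt{\sigma^2\log p}}{\|\beta\|_2}.$$ Then, with probability exceeding $1-2(k+2)p^{-1}$, the output $\hat{\mathcal{S}}$ of Algorithm 1 satisfies $\mathcal{S}\subset\hat{\mathcal{S}}$ for every integer $d\le p$ with $$d\ge\left\lceil\frac{\sqrt{k}}{\frac{\beta_{\min}}{\|\beta\|_2}-2\sqrt{\frac{8\log p}{n}}\big(\frac{b_*}{\sigma_*}\big)-\frac{4\sqrt{\sigma^2\log p}}{\|\beta\|_2}}\right\rceil.$$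
   Context: A zero-mean random variable $Z$ follows $\mathrm{subG}(B)$ if $\mathbb{E}[\exp(\lambda Z)]\le\exp(B^2\lambda^2/2)$ for all $\lambda\in\mathbb{R}$. $V_j$ is the $j$-th column of $V$. $[[p]]=\{1,\dots,p\}$, $p\ge2$, $k<n$, $\sigma>0$. $\beta$ is $k$-sparse with support $\mathcal{S}=\{i:\beta_i\ne0\}$, $|\mathcal{S}|=k$, and $\beta_{\min}=\min_{i\in\mathcal{S}}|\beta_i|$. Algorithm 1: given $X$, $y$ and an integer $d\in\{1,\dots,p\}$, compute $w=X^\top y$ and output $\hat{\mathcal{S}}\subset[[p]]$ with $|\hat{\mathcal{S}}|=d$ such that $|w_i|\ge|w_j|$ for all $i\in\hat{\mathcal{S}}$, $j\notin\hat{\mathcal{S}}$ (indices of the $d$ largest $|w_i|$, ties broken arbitrarily). *)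

theory Defs
  imports "HOL-Probability.Probability"
begin

definition subG :: "'a measure \<Rightarrow> ('a \<Rightarrow> real) \<Rightarrow> real \<Rightarrow> bool" where
  "subG M Z B \<longleftrightarrow> Z \<in> borel_measurable M \<and> integrable M Z \<and> (\<integral>x. Z x \<partial>M) = 0 \<and>
     (\<forall>l::real. (\<integral>\<^sup>+x. ennreal (exp (l * Z x)) \<partial>M) \<le> ennreal (exp (B\<^sup>2 * l\<^sup>2 / 2)))"

definition col_norm :: "nat \<Rightarrow> (nat \<Rightarrow> nat \<Rightarrow> real) \<Rightarrow> nat \<Rightarrow> real" where
  "col_norm n V j = sqrt (\<Sum>i<n. (V i j)\<^sup>2)"

definition normalize_cols :: "nat \<Rightarrow> (nat \<Rightarrow> nat \<Rightarrow> real) \<Rightarrow> nat \<Rightarrow> nat \<Rightarrow> real" where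
  "normalize_cols n V i j = V i j / col_norm n V j"

definition mat_vec :: "nat \<Rightarrow> (nat \<Rightarrow> nat \<Rightarrow> real) \<Rightarrow> (nat \<Rightarrow> real) \<Rightarrow> nat \<Rightarrow> real" where
  "mat_vec p X b i = (\<Sum>j<p. X i j * b j)"

definition tmat_vec :: "nat \<Rightarrow> (nat \<Rightarrow> nat \<Rightarrow> real) \<Rightarrow> (nat \<Rightarrow> real) \<Rightarrow> nat \<Rightarrow> real" where
  "tmat_vec n X y j = (\<Sum>i<n. X i j * y i)"

text \<open>Sh is a possible output of Algorithm 1 (indices of the d largest |w_i|, ties arbitrary),
  for w = X^T y, index set {0..p-1}.\<close>
definition alg1_output :: "nat \<Rightarrow> nat \<Rightarrow> (nat \<Rightarrow> nat \<Rightarrow> real) \<Rightarrow> (nat \<Rightarrow> real) \<Rightarrow> nat \<Rightarrow> nat set \<Rightarrow> bool" where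
  "alg1_output n p X y d Sh \<longleftrightarrow>
     (let w = tmat_vec n X y in
       Sh \<subseteq> {..<p} \<and> card Sh = d \<and> (\<forall>i\<in>Sh. \<forall>j\<in>{..<p} - Sh. \<bar>w i\<bar> \<ge> \<bar>w j\<bar>))"

end

theory Submission
  imports Defs
begin

text \<open>
  Write L = log p, r for the minimal ratio of standard deviation to sub-Gaussian parameter on the
  support S, and e = sqrt (8 L / n) / r * norm beta + 2 sigma sqrt L. If every correlation satisfies
  |w_j - beta_j| <= e and some index of S is missing from the output, then summing |w_j| over the
  output gives d (betamin - 2 e) < norm_1 beta <= sqrt k norm beta, against the lower bound on d.

  The deviation w_j - beta_j splits into a noise term and the cross term
  sum over l in S - {j} of beta_l <X_j, V_l> / norm V_l. Both are treated conditionally on column j,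
  that is, for a fixed direction u = X_j of norm at most 1. The difficulty in the cross term is that
  norm V_l depends on <u, V_l>, so the summands need not be centred. Outside an event of probability
  k p^(-2) the norm may be replaced by h = max (norm V_l) c with c^2 = (7/8) n s_l^2. Put
  z = lam <u, V_l> / h and W = lam <u, V_l> / c. As z is W shrunk towards 0 and exp t - 1 - t is
  convex with minimum 0 at t = 0, we get exp z <= exp W + z - W, and hence E exp z is at most the
  sub-Gaussian bound for W plus the bias E z. Since E <u, V_l> = 0, the bias is controlled by the
  variance of norm V_l ^2, that is, by fourth moments. The crude bound E x^4 <= 16 b^4 is too weak
  for small r; truncation at x^2 ~ (4/3) b^2 L gives roughly E x^4 <= (4/3) L b^2 s^2, and this
  suffices because k <= min n p.
\<close>

subsection \<open>Moments of sub-Gaussian variables\<close>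

lemma twice_le_exp: "2 * z \<le> exp (z::real)"
proof (cases "z \<ge> 0")
  case True
  have "0 \<le> (z - 1)\<^sup>2 / 2 + 1 / 2" by simp
  then have "2 * z \<le> 1 + z + z\<^sup>2 / 2"
    by (simp add: power2_eq_square field_simps)
  then show ?thesis using exp_lower_Taylor_quadratic[OF True] by simp
next
  case False
  then have "2 * z \<le> 0" by simp
  then show ?thesis using exp_gt_zero[of z] by linarith
qed

lemma square_le_exp:
  fixes z :: real
  assumes "z \<ge> 0"
  shows "z\<^sup>2 \<le> exp z"
proof -
  have "z \<le> exp (z / 2)" using twice_le_exp[of "z / 2"] by simp
  then have "z\<^sup>2 \<le> (exp (z / 2))\<^sup>2" using assms by (intro power_mono)
  also have "\<dots> = exp z" by (simp add: exp_double[symmetric])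
  finally show ?thesis .
qed

text \<open>The reason is \<open>(1 - z + z^2/2) (1 + z + z^2/2) = 1 + z^4/4 >= 1\<close>, combined
  with the quadratic lower bound for \<open>exp z\<close>. It lets second and fourth moments alone
  control the lower tail of a sum of squares.\<close>

lemma exp_minus_le_quadratic:
  fixes z :: real
  assumes "z \<ge> 0"
  shows "exp (- z) \<le> 1 - z + z\<^sup>2 / 2"
proof -
  have pos: "0 < 1 + z + z\<^sup>2 / 2" using assms by (simp add: add_pos_nonneg)
  have "exp (- z) = 1 / exp z" by (simp add: exp_minus inverse_eq_divide)
  also have "\<dots> \<le> 1 / (1 + z + z\<^sup>2 / 2)"
    using pos exp_lower_Taylor_quadratic[OF assms] by (intro divide_left_mono) auto
  also have "\<dots> \<le> 1 - z + z\<^sup>2 / 2"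
  proof -
    have "1 \<le> 1 + (z\<^sup>2)\<^sup>2 / 4" by simp
    also have "\<dots> = (1 - z + z\<^sup>2 / 2) * (1 + z + z\<^sup>2 / 2)"
      by (simp add: power2_eq_square algebra_simps)
    finally show ?thesis using pos by (simp only: pos_divide_le_eq)
  qed
  finally show ?thesis .
qed

text \<open>Convexity between 0 and \<open>t\<close> gives
  \<open>exp (r t) <= (1 - r) + r exp t\<close>, and \<open>1 + t <= exp t\<close> trades the
  constant \<open>1 - r\<close> for a linear term. The bound is pointwise, so \<open>r\<close> may
  later be random and dependent on \<open>t\<close>.\<close>

lemma exp_shrink_le:
  fixes t r :: real
  assumes "0 \<le> r" "r \<le> 1"
  shows "exp (r * t) \<le> exp t + r * t - t"
proof -
  have "exp ((1 - r) *\<^sub>R 0 + r *\<^sub>R t) \<le> (1 - r) * exp 0 + r * exp t"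
    using convex_onD[OF convex_on_exp[of 1], of r 0 t] assms by simp
  moreover have "(1 - r) * (1 + t) \<le> (1 - r) * exp t"
    using assms by (intro mult_left_mono) auto
  ultimately show ?thesis by (simp add: algebra_simps)
qed

text \<open>Bounds E x^4 by a multiple of E x^2 up to an exponentially small error, with y = (x / B)^2 and truncation level T.\<close>

lemma square_le_linear_plus_exp:
  fixes y T :: real
  assumes y: "y \<ge> 0" and T: "T \<ge> 0"
  shows "y\<^sup>2 \<le> T * y + (64 / 9 + 4 / 3 * T) * (exp (- (3 / 8) * T) * exp (3 / 8 * y))"
proof (cases "y \<le> T")
  case True
  then have "y\<^sup>2 \<le> T * y" using y by (simp add: power2_eq_square mult_right_mono)
  moreover have "0 \<le> (64 / 9 + 4 / 3 * T) * (exp (- (3 / 8) * T) * exp (3 / 8 * y))"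
    using T by simp
  ultimately show ?thesis by linarith
next
  case False
  \<comment> \<open>Excess over the truncation level on the scale of the exponent. Substituting
    \<open>y = T + 8/3 z\<close> leaves \<open>64/9 z^2 + 8/3 T z\<close> beyond \<open>T y\<close>,
    the origin of the two constants.\<close>
  define z where "z = 3 / 8 * (y - T)"
  have z8: "8 * z = 3 * y - 3 * T" by (simp add: z_def)
  have z0: "z \<ge> 0" using False by (simp add: z_def)
  have zy: "y = T + 8 / 3 * z" using z8 by linarith
  note z = z0 zy
  have "y\<^sup>2 = T * y + (64 / 9 * z\<^sup>2 + 4 / 3 * T * (2 * z))"
    unfolding z(2) by (simp add: power2_eq_square algebra_simps)
  also have "\<dots> \<le> T * y + (64 / 9 * exp z + 4 / 3 * T * exp z)"
    using z T by (intro add_left_mono add_mono mult_left_mono square_le_exp twice_le_exp) auto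
  also have "exp z = exp (- (3 / 8) * T) * exp (3 / 8 * y)"
  proof -
    have "z = - (3 / 8) * T + 3 / 8 * y" using z8 by linarith
    then show ?thesis by (simp only: exp_add)
  qed
  finally show ?thesis by (simp only: distrib_right mult.assoc)
qed

text \<open>Completing the square: tilting the centred Gaussian density in \<open>l\<close> by
  \<open>exp (l x)\<close> moves its mean to \<open>\<tau>^2 x\<close> and releases a factor
  independent of \<open>l\<close>.\<close>

lemma normal_density_mult_exp:
  assumes "\<tau> > 0"
  shows "normal_density 0 \<tau> l * exp (l * x) = exp (\<tau>\<^sup>2 * x\<^sup>2 / 2) * normal_density (\<tau>\<^sup>2 * x) \<tau> l"
proof -
  have "- l\<^sup>2 / (2 * \<tau>\<^sup>2) + l * x = \<tau>\<^sup>2 * x\<^sup>2 / 2 + (- (l - \<tau>\<^sup>2 * x)\<^sup>2 / (2 * \<tau>\<^sup>2))"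
    using assms by (simp add: power2_eq_square field_simps)
  then show ?thesis
    by (simp add: normal_density_def exp_add[symmetric] algebra_simps)
qed

lemma nn_integral_normal_density:
  assumes "\<tau> > 0"
  shows "(\<integral>\<^sup>+x. ennreal (normal_density \<mu> \<tau> x) \<partial>lborel) = 1"
  using assms by (subst nn_integral_eq_integral) auto

text \<open>Serves twice: read from right to left it linearizes the exponential of a square, and
  with the integration variable as the random value it is the moment generating function of the
  noise.\<close>

lemma normal_mgf:
  assumes "\<tau> > 0"
  shows "(\<integral>\<^sup>+l. ennreal (normal_density 0 \<tau> l * exp (l * x)) \<partial>lborel) = ennreal (exp (\<tau>\<^sup>2 * x\<^sup>2 / 2))"
  using assms
  by (simp add: normal_density_mult_exp ennreal_mult nn_integral_cmult nn_integral_normal_density)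

context prob_space
begin

text \<open>Integrates the moment generating function against a centred Gaussian of variance 3 / (4 B^2).\<close>

lemma subG_exp_square_nn:
  assumes Z: "subG M Z B" and B: "B > 0"
  shows "(\<integral>\<^sup>+x. ennreal (exp (3 / 8 * (Z x / B)\<^sup>2)) \<partial>M) \<le> 2"
proof -
  have [measurable]: "Z \<in> borel_measurable M" using Z by (simp add: subG_def)
  \<comment> \<open>\<open>\<tau>\<close> is chosen so that
    \<open>\<tau>^2 x^2 / 2 = 3/8 (x / B)^2\<close>. Multiplying its density by
    \<open>exp (B^2 l^2 / 2)\<close> leaves a Gaussian profile of deviation
    \<open>\<rho> = 2 \<tau>\<close>; this ratio of deviations is the final bound 2.\<close>
  define \<tau> \<rho> where "\<tau> = sqrt 3 / (2 * B)" and "\<rho> = sqrt 3 / B"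
  have \<tau>: "\<tau> > 0" "\<tau>\<^sup>2 = 3 / (4 * B\<^sup>2)" and \<rho>: "\<rho> > 0" "\<rho>\<^sup>2 = 3 / B\<^sup>2"
    using B by (auto simp: \<tau>_def \<rho>_def power_divide power_mult_distrib)
  interpret P: pair_sigma_finite lborel M ..
  have "(\<integral>\<^sup>+x. ennreal (exp (3 / 8 * (Z x / B)\<^sup>2)) \<partial>M) =
      (\<integral>\<^sup>+x. \<integral>\<^sup>+l. ennreal (normal_density 0 \<tau> l * exp (l * Z x)) \<partial>lborel \<partial>M)"
    by (subst normal_mgf[OF \<tau>(1)]) (simp add: \<tau>(2) power_divide)
  also have "\<dots> = (\<integral>\<^sup>+l. \<integral>\<^sup>+x. ennreal (normal_density 0 \<tau> l * exp (l * Z x)) \<partial>M \<partial>lborel)"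
    by (rule P.Fubini') measurable
  also have "\<dots> = (\<integral>\<^sup>+l. normal_density 0 \<tau> l * (\<integral>\<^sup>+x. ennreal (exp (l * Z x)) \<partial>M) \<partial>lborel)"
    by (simp add: ennreal_mult nn_integral_cmult)
  also have "\<dots> \<le> (\<integral>\<^sup>+l. ennreal (normal_density 0 \<tau> l) * ennreal (exp (B\<^sup>2 * l\<^sup>2 / 2)) \<partial>lborel)"
    using Z by (intro nn_integral_mono mult_left_mono) (auto simp: subG_def)
  also have "\<dots> = (\<integral>\<^sup>+l. ennreal 2 * ennreal (normal_density 0 \<rho> l) \<partial>lborel)"
  proof (rule nn_integral_cong)
    fix l :: real
    have e: "- l\<^sup>2 / (2 * \<tau>\<^sup>2) + B\<^sup>2 * l\<^sup>2 / 2 = - l\<^sup>2 / (2 * \<rho>\<^sup>2)"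
      using B unfolding \<tau>(2) \<rho>(2) by (simp add: field_simps)
    have s: "sqrt (2 * pi * \<tau>\<^sup>2) = sqrt (2 * pi * \<rho>\<^sup>2) / 2"
    proof -
      have "2 * pi * \<tau>\<^sup>2 = (2 * pi * \<rho>\<^sup>2) / 4" unfolding \<tau>(2) \<rho>(2) by simp
      then show ?thesis by (simp only: real_sqrt_divide real_sqrt_four)
    qed
    have "normal_density 0 \<tau> l * exp (B\<^sup>2 * l\<^sup>2 / 2) = 2 * normal_density 0 \<rho> l"
      unfolding normal_density_def s using e by (simp add: exp_add[symmetric])
    then show "ennreal (normal_density 0 \<tau> l) * ennreal (exp (B\<^sup>2 * l\<^sup>2 / 2)) =
        ennreal 2 * ennreal (normal_density 0 \<rho> l)"
      by (metis ennreal_mult exp_ge_zero normal_density_nonneg zero_le_numeral)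
  qed
  also have "\<dots> = 2"
    using \<rho> by (subst nn_integral_cmult) (auto simp: nn_integral_normal_density)
  finally show ?thesis .
qed

lemma subG_exp_square:
  assumes Z: "subG M Z B" and B: "B > 0"
  shows "integrable M (\<lambda>x. exp (3 / 8 * (Z x / B)\<^sup>2))"
    and "(\<integral>x. exp (3 / 8 * (Z x / B)\<^sup>2) \<partial>M) \<le> 2"
proof -
  have [measurable]: "Z \<in> borel_measurable M" using Z by (simp add: subG_def)
  note nn = subG_exp_square_nn[OF Z B]
  show int: "integrable M (\<lambda>x. exp (3 / 8 * (Z x / B)\<^sup>2))"
    by (rule integrableI_bounded) (use nn in \<open>auto simp: order_le_less_trans\<close>)
  show "(\<integral>x. exp (3 / 8 * (Z x / B)\<^sup>2) \<partial>M) \<le> 2"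
    using nn by (subst (asm) nn_integral_eq_integral[OF int]) (auto simp flip: ennreal_numeral)
qed

lemma subG_integrable_power4:
  assumes Z: "subG M Z B" and B: "B > 0"
  shows "integrable M (\<lambda>x. Z x ^ 4)"
proof -
  have [measurable]: "Z \<in> borel_measurable M" using Z by (simp add: subG_def)
  show ?thesis
  proof (rule Bochner_Integration.integrable_bound)
    \<comment> \<open>\<open>64/9 = (8/3)^2\<close> undoes the square of the factor 3/8 in the
      exponent.\<close>
    show "integrable M (\<lambda>x. 64 / 9 * B ^ 4 * exp (3 / 8 * (Z x / B)\<^sup>2))"
      using subG_exp_square(1)[OF Z B] by simp
    have "\<bar>Z x ^ 4\<bar> \<le> \<bar>64 / 9 * B ^ 4 * exp (3 / 8 * (Z x / B)\<^sup>2)\<bar>" for x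
    proof -
      have "64 / 9 * B ^ 4 * (3 / 8 * (Z x / B)\<^sup>2)\<^sup>2 \<le> 64 / 9 * B ^ 4 * exp (3 / 8 * (Z x / B)\<^sup>2)"
        by (intro mult_left_mono square_le_exp) auto
      also have "64 / 9 * B ^ 4 * (3 / 8 * (Z x / B)\<^sup>2)\<^sup>2 = Z x ^ 4"
        using B by (simp add: power_mult_distrib power_divide field_simps)
      finally show ?thesis by simp
    qed
    then show "AE x in M. norm (Z x ^ 4) \<le> norm (64 / 9 * B ^ 4 * exp (3 / 8 * (Z x / B)\<^sup>2))"
      by simp
  qed simp
qed

lemma integrable_square_of_power4:
  fixes Z :: "'a \<Rightarrow> real"
  assumes "integrable M (\<lambda>x. Z x ^ 4)" and [measurable]: "Z \<in> borel_measurable M"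
  shows "integrable M (\<lambda>x. (Z x)\<^sup>2)"
proof (rule Bochner_Integration.integrable_bound)
  show "integrable M (\<lambda>x. 1 + Z x ^ 4)" using assms by simp
  have "(Z x)\<^sup>2 \<le> 1 + Z x ^ 4" for x
    using zero_le_power2[of "(Z x)\<^sup>2 - 1"] zero_le_power2[of "(Z x)\<^sup>2"]
    by (simp add: power2_eq_square power4_eq_xxxx algebra_simps)
  then show "AE x in M. norm ((Z x)\<^sup>2) \<le> norm (1 + Z x ^ 4)" by (simp add: abs_of_nonneg)
qed simp

text \<open>\<open>exp u - 1 >= u^2 / 2\<close> for \<open>u = 3/8 (Z / B)^2\<close> gives the
  constant 128/9, rounded up to 16. This cruder bound is good enough for the lower tail of column
  norms.\<close>

lemma subG_power4_le:
  assumes Z: "subG M Z B" and B: "B > 0"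
  shows "(\<integral>x. Z x ^ 4 \<partial>M) \<le> 16 * B ^ 4"
proof -
  have "(\<integral>x. Z x ^ 4 \<partial>M) \<le> (\<integral>x. 128 / 9 * B ^ 4 * (exp (3 / 8 * (Z x / B)\<^sup>2) - 1) \<partial>M)"
  proof (rule integral_mono)
    show "integrable M (\<lambda>x. Z x ^ 4)" by (rule subG_integrable_power4[OF Z B])
    show "integrable M (\<lambda>x. 128 / 9 * B ^ 4 * (exp (3 / 8 * (Z x / B)\<^sup>2) - 1))"
      using subG_exp_square(1)[OF Z B] by simp
    fix x
    have "1 + (3 / 8 * (Z x / B)\<^sup>2)\<^sup>2 / 2 \<le> exp (3 / 8 * (Z x / B)\<^sup>2)"
      by (rule order_trans[OF _ exp_lower_Taylor_quadratic]) auto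
    then have "128 / 9 * B ^ 4 * ((3 / 8 * (Z x / B)\<^sup>2)\<^sup>2 / 2) \<le> 128 / 9 * B ^ 4 * (exp (3 / 8 * (Z x / B)\<^sup>2) - 1)"
      by (intro mult_left_mono) auto
    also have "128 / 9 * B ^ 4 * ((3 / 8 * (Z x / B)\<^sup>2)\<^sup>2 / 2) = Z x ^ 4"
      using B by (simp add: power_mult_distrib power_divide field_simps)
    finally show "Z x ^ 4 \<le> 128 / 9 * B ^ 4 * (exp (3 / 8 * (Z x / B)\<^sup>2) - 1)" .
  qed
  also have "\<dots> = 128 / 9 * B ^ 4 * ((\<integral>x. exp (3 / 8 * (Z x / B)\<^sup>2) \<partial>M) - 1)"
    using subG_exp_square(1)[OF Z B] by (simp add: prob_space)
  also have "\<dots> \<le> 128 / 9 * B ^ 4 * (2 - 1)"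
    using subG_exp_square(2)[OF Z B] by (intro mult_left_mono) auto
  also have "\<dots> \<le> 16 * B ^ 4" by simp
  finally show ?thesis .
qed

text \<open>Uses the linear term of the same expansion. It caps the ratio of standard deviation to
  sub-Gaussian parameter, which forces \<open>n\<close> to be large even when \<open>p\<close> is
  small.\<close>

lemma subG_power2_le:
  assumes Z: "subG M Z B" and B: "B > 0"
  shows "(\<integral>x. (Z x)\<^sup>2 \<partial>M) \<le> 8 / 3 * B\<^sup>2"
proof -
  have [measurable]: "Z \<in> borel_measurable M" using Z by (simp add: subG_def)
  have "(\<integral>x. (Z x)\<^sup>2 \<partial>M) \<le> (\<integral>x. 8 / 3 * B\<^sup>2 * (exp (3 / 8 * (Z x / B)\<^sup>2) - 1) \<partial>M)"
  proof (rule integral_mono)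
    show "integrable M (\<lambda>x. (Z x)\<^sup>2)"
      by (rule integrable_square_of_power4[OF subG_integrable_power4[OF Z B]]) simp
    show "integrable M (\<lambda>x. 8 / 3 * B\<^sup>2 * (exp (3 / 8 * (Z x / B)\<^sup>2) - 1))"
      using subG_exp_square(1)[OF Z B] by simp
    fix x
    have "1 + 3 / 8 * (Z x / B)\<^sup>2 \<le> exp (3 / 8 * (Z x / B)\<^sup>2)" by (rule exp_ge_add_one_self)
    then have "8 / 3 * B\<^sup>2 * (3 / 8 * (Z x / B)\<^sup>2) \<le> 8 / 3 * B\<^sup>2 * (exp (3 / 8 * (Z x / B)\<^sup>2) - 1)"
      by (intro mult_left_mono) (linarith, simp)
    also have "8 / 3 * B\<^sup>2 * (3 / 8 * (Z x / B)\<^sup>2) = (Z x)\<^sup>2"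
      using B by (simp add: power_divide)
    finally show "(Z x)\<^sup>2 \<le> 8 / 3 * B\<^sup>2 * (exp (3 / 8 * (Z x / B)\<^sup>2) - 1)" .
  qed
  also have "\<dots> = 8 / 3 * B\<^sup>2 * ((\<integral>x. exp (3 / 8 * (Z x / B)\<^sup>2) \<partial>M) - 1)"
    using subG_exp_square(1)[OF Z B] by (simp add: prob_space)
  also have "\<dots> \<le> 8 / 3 * B\<^sup>2 * (2 - 1)"
    using subG_exp_square(2)[OF Z B] by (intro mult_left_mono) auto
  finally show ?thesis by simp
qed

text \<open>Integrates \<open>square_le_linear_plus_exp\<close> at \<open>y = (Z / B)^2\<close>; the
  factor 2 in the error is the bound on the exponential moment. The main term carries the true
  variance instead of a second factor \<open>B^2\<close>.\<close>

lemma subG_power4_le_truncated: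
  assumes Z: "subG M Z B" and B: "B > 0" and T: "T \<ge> 0"
  shows "(\<integral>x. Z x ^ 4 \<partial>M) \<le>
    T * B\<^sup>2 * (\<integral>x. (Z x)\<^sup>2 \<partial>M) + 2 * (64 / 9 + 4 / 3 * T) * B ^ 4 * exp (- (3 / 8) * T)"
proof -
  have [measurable]: "Z \<in> borel_measurable M" using Z by (simp add: subG_def)
  define K where "K = (64 / 9 + 4 / 3 * T) * B ^ 4 * exp (- (3 / 8) * T)"
  have K: "K \<ge> 0" using T by (simp add: K_def)
  have int2: "integrable M (\<lambda>x. (Z x)\<^sup>2)"
    by (rule integrable_square_of_power4[OF subG_integrable_power4[OF Z B]]) simp
  note intE = subG_exp_square(1)[OF Z B]
  have "(\<integral>x. Z x ^ 4 \<partial>M) \<le> (\<integral>x. T * B\<^sup>2 * (Z x)\<^sup>2 + K * exp (3 / 8 * (Z x / B)\<^sup>2) \<partial>M)"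
  proof (rule integral_mono)
    show "integrable M (\<lambda>x. Z x ^ 4)" by (rule subG_integrable_power4[OF Z B])
    show "integrable M (\<lambda>x. T * B\<^sup>2 * (Z x)\<^sup>2 + K * exp (3 / 8 * (Z x / B)\<^sup>2))"
      using intE int2 by simp
    fix x
    have "Z x ^ 4 = B ^ 4 * ((Z x / B)\<^sup>2)\<^sup>2"
      using B by (simp add: power_divide)
    also have "\<dots> \<le> B ^ 4 * (T * (Z x / B)\<^sup>2 +
        (64 / 9 + 4 / 3 * T) * (exp (- (3 / 8) * T) * exp (3 / 8 * (Z x / B)\<^sup>2)))"
      using T by (intro mult_left_mono square_le_linear_plus_exp) auto
    also have "\<dots> = T * B\<^sup>2 * (Z x)\<^sup>2 + K * exp (3 / 8 * (Z x / B)\<^sup>2)"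
    proof -
      have "B ^ 4 * (T * (Z x / B)\<^sup>2) = T * B\<^sup>2 * (Z x)\<^sup>2"
        using B by (simp add: power_divide power2_eq_square power4_eq_xxxx)
      then show ?thesis by (simp add: K_def algebra_simps)
    qed
    finally show "Z x ^ 4 \<le> T * B\<^sup>2 * (Z x)\<^sup>2 + K * exp (3 / 8 * (Z x / B)\<^sup>2)" .
  qed
  also have "\<dots> = T * B\<^sup>2 * (\<integral>x. (Z x)\<^sup>2 \<partial>M) + K * (\<integral>x. exp (3 / 8 * (Z x / B)\<^sup>2) \<partial>M)"
    using intE int2 by simp
  also have "\<dots> \<le> T * B\<^sup>2 * (\<integral>x. (Z x)\<^sup>2 \<partial>M) + K * 2"
    using subG_exp_square(2)[OF Z B] K by (intro add_left_mono mult_left_mono)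
  also have "K * 2 = 2 * (64 / 9 + 4 / 3 * T) * B ^ 4 * exp (- (3 / 8) * T)"
    by (simp only: K_def mult_ac)
  finally show ?thesis .
qed


subsection \<open>Independent sums and conditioning\<close>

lemma indep_vars_exp_sum_le:
  fixes X :: "'i \<Rightarrow> 'a \<Rightarrow> real"
  assumes I: "finite I" and ind: "indep_vars (\<lambda>_. borel) X I"
    and mgf: "\<And>i. i \<in> I \<Longrightarrow> (\<integral>\<^sup>+x. ennreal (exp (X i x)) \<partial>M) \<le> ennreal (exp (c i))"
  shows "(\<integral>\<^sup>+x. ennreal (exp (\<Sum>i\<in>I. X i x)) \<partial>M) \<le> ennreal (exp (\<Sum>i\<in>I. c i))"
proof -
  have "(\<integral>\<^sup>+x. ennreal (exp (\<Sum>i\<in>I. X i x)) \<partial>M) = (\<integral>\<^sup>+x. (\<Prod>i\<in>I. ennreal (exp (X i x))) \<partial>M)"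
    by (simp add: exp_sum I prod_ennreal)
  also have "\<dots> = (\<Prod>i\<in>I. \<integral>\<^sup>+x. ennreal (exp (X i x)) \<partial>M)"
    by (intro indep_vars_nn_integral I indep_vars_compose2[OF ind]) auto
  also have "\<dots> \<le> (\<Prod>i\<in>I. ennreal (exp (c i)))"
    by (intro prod_mono_ennreal mgf)
  also have "\<dots> = ennreal (exp (\<Sum>i\<in>I. c i))"
    by (simp add: exp_sum I prod_ennreal)
  finally show ?thesis .
qed

lemma prob_ge_le_exp:
  fixes Z :: "'a \<Rightarrow> real"
  assumes [measurable]: "Z \<in> borel_measurable M" and l: "l > 0"
    and mgf: "(\<integral>\<^sup>+x. ennreal (exp (l * Z x)) \<partial>M) \<le> ennreal (exp a)"
  shows "prob {x \<in> space M. Z x \<ge> t} \<le> exp (a - l * t)"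
proof -
  have "emeasure M {x \<in> space M. Z x \<ge> t} \<le> ennreal (exp (- l * t)) * (\<integral>\<^sup>+x. ennreal (exp (l * Z x)) * indicator (space M) x \<partial>M)"
    using l by (intro Chernoff_ineq_nn_integral_ge) auto
  also have "(\<integral>\<^sup>+x. ennreal (exp (l * Z x)) * indicator (space M) x \<partial>M) = (\<integral>\<^sup>+x. ennreal (exp (l * Z x)) \<partial>M)"
    by (intro nn_integral_cong) auto
  also have "ennreal (exp (- l * t)) * \<dots> \<le> ennreal (exp (- l * t)) * ennreal (exp a)"
    by (intro mult_left_mono mgf) auto
  also have "\<dots> = ennreal (exp (a - l * t))"
    by (simp add: ennreal_mult[symmetric] exp_add[symmetric])
  finally show ?thesis by (simp add: emeasure_eq_measure)
qed

text \<open>The hypothesis concerns only the two tilts \<open>l\<close> and \<open>- l\<close>, with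
  a common exponent \<open>a\<close>: the exponents arising later depend on the tilt through its
  absolute value.\<close>

lemma prob_abs_ge_le_exp:
  fixes Z :: "'a \<Rightarrow> real"
  assumes [measurable]: "Z \<in> borel_measurable M" and l: "l > 0"
    and mgf: "\<And>l'. \<bar>l'\<bar> = l \<Longrightarrow> (\<integral>\<^sup>+x. ennreal (exp (l' * Z x)) \<partial>M) \<le> ennreal (exp a)"
  shows "prob {x \<in> space M. \<bar>Z x\<bar> \<ge> t} \<le> 2 * exp (a - l * t)"
proof -
  have "prob {x \<in> space M. \<bar>Z x\<bar> \<ge> t} \<le> prob ({x \<in> space M. Z x \<ge> t} \<union> {x \<in> space M. - Z x \<ge> t})"
    by (intro finite_measure_mono) auto
  also have "\<dots> \<le> prob {x \<in> space M. Z x \<ge> t} + prob {x \<in> space M. - Z x \<ge> t}"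
    by (intro measure_Un_le) auto
  also have "\<dots> \<le> exp (a - l * t) + exp (a - l * t)"
    using mgf[of l] mgf[of "- l"] l by (intro add_mono prob_ge_le_exp) auto
  finally show ?thesis by simp
qed

text \<open>Cross terms vanish by independence and zero means. Integrability of the squared sum is
  carried through the same induction, since splitting the integral requires it.\<close>

lemma indep_vars_sum_square:
  fixes X :: "'i \<Rightarrow> 'a \<Rightarrow> real"
  assumes "finite I" "indep_vars (\<lambda>_. borel) X I"
    and "\<And>i. i \<in> I \<Longrightarrow> integrable M (\<lambda>x. (X i x)\<^sup>2)"
    and "\<And>i. i \<in> I \<Longrightarrow> expectation (X i) = 0"
  shows "integrable M (\<lambda>x. (\<Sum>i\<in>I. X i x)\<^sup>2) \<and>
    (\<integral>x. (\<Sum>i\<in>I. X i x)\<^sup>2 \<partial>M) = (\<Sum>i\<in>I. \<integral>x. (X i x)\<^sup>2 \<partial>M)"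
  using assms
proof (induction I rule: finite_induct)
  case empty
  then show ?case by simp
next
  case (insert i I)
  let ?S = "\<lambda>x. \<Sum>i\<in>I. X i x"
  have meas: "X j \<in> borel_measurable M" if "j \<in> insert i I" for j
    using insert.prems(1) that by (auto simp: indep_vars_def)
  have [measurable]: "X i \<in> borel_measurable M" "?S \<in> borel_measurable M"
    using meas by (auto intro!: borel_measurable_sum)
  have int: "integrable M (X j)" if "j \<in> insert i I" for j
    using meas[OF that] insert.prems(2)[OF that] by (rule square_integrable_imp_integrable)
  have IH: "integrable M (\<lambda>x. (?S x)\<^sup>2)" "(\<integral>x. (?S x)\<^sup>2 \<partial>M) = (\<Sum>i\<in>I. \<integral>x. (X i x)\<^sup>2 \<partial>M)"
    using insert.IH[OF indep_vars_subset[OF insert.prems(1)]] insert.prems by auto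
  have iv: "indep_var borel (X i) borel ?S"
    using insert by (intro indep_vars_sum) auto
  have intS: "integrable M ?S" using int by (intro Bochner_Integration.integrable_sum) auto
  have cross: "integrable M (\<lambda>x. X i x * ?S x)" "(\<integral>x. X i x * ?S x \<partial>M) = 0"
    using indep_var_integrable[OF iv _ intS] indep_var_lebesgue_integral[OF iv _ intS]
      int[of i] insert.prems(3)[of i] by auto
  have sq: "(\<Sum>j\<in>insert i I. X j x)\<^sup>2 = (X i x)\<^sup>2 + 2 * (X i x * ?S x) + (?S x)\<^sup>2" for x
    using insert.hyps by (simp add: power2_sum)
  show ?case
    unfolding sq using insert.hyps insert.prems(2)[of i] IH cross by simp
qed

lemma indep_var_nn_integral_le:
  assumes ind: "indep_var N1 X N2 Y"
    and f[measurable]: "(\<lambda>(x, y). f x y) \<in> borel_measurable (N1 \<Otimes>\<^sub>M N2)"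
    and le: "\<And>x. x \<in> space N1 \<Longrightarrow> (\<integral>\<^sup>+\<omega>. f x (Y \<omega>) \<partial>M) \<le> C"
  shows "(\<integral>\<^sup>+\<omega>. f (X \<omega>) (Y \<omega>) \<partial>M) \<le> C"
proof -
  have X[measurable]: "X \<in> measurable M N1" and Y[measurable]: "Y \<in> measurable M N2"
    and eq: "distr M N1 X \<Otimes>\<^sub>M distr M N2 Y = distr M (N1 \<Otimes>\<^sub>M N2) (\<lambda>x. (X x, Y x))"
    using ind by (auto simp: indep_var_distribution_eq)
  interpret PX: prob_space "distr M N1 X" by (rule prob_space_distr) fact
  interpret PY: prob_space "distr M N2 Y" by (rule prob_space_distr) fact
  have "(\<integral>\<^sup>+\<omega>. f (X \<omega>) (Y \<omega>) \<partial>M) = (\<integral>\<^sup>+z. (\<lambda>(x, y). f x y) z \<partial>distr M (N1 \<Otimes>\<^sub>M N2) (\<lambda>x. (X x, Y x)))"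
    by (subst nn_integral_distr) auto
  also have "\<dots> = (\<integral>\<^sup>+z. (\<lambda>(x, y). f x y) z \<partial>(distr M N1 X \<Otimes>\<^sub>M distr M N2 Y))"
    by (simp add: eq)
  also have "\<dots> = (\<integral>\<^sup>+x. \<integral>\<^sup>+y. f x y \<partial>distr M N2 Y \<partial>distr M N1 X)"
    by (subst PY.nn_integral_fst[symmetric]) auto
  also have "\<dots> \<le> (\<integral>\<^sup>+x. C \<partial>distr M N1 X)"
  proof (rule nn_integral_mono)
    fix x assume "x \<in> space (distr M N1 X)"
    then have x: "x \<in> space N1" by simp
    then have [measurable]: "f x \<in> borel_measurable N2"
      using measurable_Pair2[OF f x] by simp
    show "(\<integral>\<^sup>+y. f x y \<partial>distr M N2 Y) \<le> C"
      using le[OF x] by (simp add: nn_integral_distr)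
  qed
  also have "\<dots> = C" using PX.emeasure_space_1 by simp
  finally show ?thesis .
qed

text \<open>The quadratic bound for \<open>exp (- z)\<close> at \<open>z = l Z^2\<close> involves
  only moments of order 2 and 4; 8 is half of the fourth-moment constant 16.\<close>

lemma subG_lower_tail_square_mgf:
  assumes Z: "subG M Z B" and B: "B > 0" and l: "l \<ge> 0"
  shows "(\<integral>\<^sup>+x. ennreal (exp (- l * (Z x)\<^sup>2)) \<partial>M) \<le> ennreal (exp (- l * (\<integral>x. (Z x)\<^sup>2 \<partial>M) + 8 * l\<^sup>2 * B ^ 4))"
proof -
  have [measurable]: "Z \<in> borel_measurable M" using Z by (simp add: subG_def)
  note i4 = subG_integrable_power4[OF Z B]
  have i2: "integrable M (\<lambda>x. (Z x)\<^sup>2)" by (rule integrable_square_of_power4[OF i4]) simp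
  have iE: "integrable M (\<lambda>x. exp (- l * (Z x)\<^sup>2))"
    by (rule integrable_const_bound[of _ 1]) (use l in auto)
  have "(\<integral>x. exp (- l * (Z x)\<^sup>2) \<partial>M) \<le> (\<integral>x. 1 - l * (Z x)\<^sup>2 + l\<^sup>2 / 2 * Z x ^ 4 \<partial>M)"
  proof (rule integral_mono)
    fix x
    have "exp (- (l * (Z x)\<^sup>2)) \<le> 1 - l * (Z x)\<^sup>2 + (l * (Z x)\<^sup>2)\<^sup>2 / 2"
      using l by (intro exp_minus_le_quadratic) auto
    then show "exp (- l * (Z x)\<^sup>2) \<le> 1 - l * (Z x)\<^sup>2 + l\<^sup>2 / 2 * Z x ^ 4"
      by (simp add: power_mult_distrib)
  qed (use iE i2 i4 in auto)
  also have "\<dots> = 1 - l * (\<integral>x. (Z x)\<^sup>2 \<partial>M) + l\<^sup>2 / 2 * (\<integral>x. Z x ^ 4 \<partial>M)"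
    using i2 i4 by (simp add: prob_space)
  also have "\<dots> \<le> 1 - l * (\<integral>x. (Z x)\<^sup>2 \<partial>M) + l\<^sup>2 / 2 * (16 * B ^ 4)"
    using subG_power4_le[OF Z B] by (intro add_left_mono mult_left_mono) auto
  also have "\<dots> \<le> exp (- l * (\<integral>x. (Z x)\<^sup>2 \<partial>M) + 8 * l\<^sup>2 * B ^ 4)"
    by (rule order_trans[OF _ exp_ge_add_one_self]) simp
  finally show ?thesis
    by (subst nn_integral_eq_integral[OF iE]) auto
qed

lemma subG_norm_lower_tail:
  fixes x :: "nat \<Rightarrow> 'a \<Rightarrow> real"
  assumes ind: "indep_vars (\<lambda>_. borel) x {..<n}"
    and sub: "\<And>i. i < n \<Longrightarrow> subG M (x i) B" and B: "B > 0" and s: "s > 0"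
    and var: "\<And>i. i < n \<Longrightarrow> (\<integral>\<omega>. (x i \<omega>)\<^sup>2 \<partial>M) = s\<^sup>2"
  shows "prob {\<omega> \<in> space M. (\<Sum>i<n. (x i \<omega>)\<^sup>2) \<le> 7 / 8 * real n * s\<^sup>2} \<le> exp (- real n * (s / B) ^ 4 / 2048)"
proof -
  have meas[measurable]: "x i \<in> borel_measurable M" if "i < n" for i
    using sub[OF that] by (simp add: subG_def)
  \<comment> \<open>Minimizes the exponent per entry, \<open>- l s^2 / 8 + 8 l^2 B^4\<close>, whose
    minimum is \<open>- (s / B)^4 / 2048\<close>.\<close>
  define l where "l = s\<^sup>2 / (128 * B ^ 4)"
  have l: "l > 0" using s B by (simp add: l_def)
  have "(\<integral>\<^sup>+\<omega>. ennreal (exp (\<Sum>i<n. - l * (x i \<omega>)\<^sup>2)) \<partial>M) \<le> ennreal (exp (\<Sum>i<n. - l * s\<^sup>2 + 8 * l\<^sup>2 * B ^ 4))"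
  proof (rule indep_vars_exp_sum_le)
    show "indep_vars (\<lambda>_. borel) (\<lambda>i \<omega>. - l * (x i \<omega>)\<^sup>2) {..<n}"
      by (rule indep_vars_compose2[OF ind]) auto
    show "(\<integral>\<^sup>+\<omega>. ennreal (exp (- l * (x i \<omega>)\<^sup>2)) \<partial>M) \<le> ennreal (exp (- l * s\<^sup>2 + 8 * l\<^sup>2 * B ^ 4))"
      if "i \<in> {..<n}" for i
      using subG_lower_tail_square_mgf[OF sub B, of i l] that l by (simp add: var)
  qed simp
  also have "(\<lambda>\<omega>. \<Sum>i<n. - l * (x i \<omega>)\<^sup>2) = (\<lambda>\<omega>. l * (- (\<Sum>i<n. (x i \<omega>)\<^sup>2)))"
    by (simp add: sum_distrib_left sum_negf)
  finally have "prob {\<omega> \<in> space M. - (\<Sum>i<n. (x i \<omega>)\<^sup>2) \<ge> - (7 / 8 * real n * s\<^sup>2)}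
      \<le> exp ((\<Sum>i<n. - l * s\<^sup>2 + 8 * l\<^sup>2 * B ^ 4) - l * (- (7 / 8 * real n * s\<^sup>2)))"
    using l by (intro prob_ge_le_exp) auto
  also have "(\<Sum>i<n. - l * s\<^sup>2 + 8 * l\<^sup>2 * B ^ 4) - l * (- (7 / 8 * real n * s\<^sup>2)) = - real n * (s / B) ^ 4 / 2048"
    using B s by (simp add: l_def field_simps power2_eq_square power4_eq_xxxx)
  finally show ?thesis by simp
qed

end

subsection \<open>Self-normalized linear forms\<close>

text \<open>With \<open>h = max (sqrt Q) c\<close> the difference is
  \<open>(N^2 - h^2) / (N h (N + h))\<close>, and the floor \<open>c\<close> keeps the denominator
  away from 0. The bound depends on \<open>Q\<close> only through its deviation from
  \<open>N^2\<close>, so a variance controls it later.\<close>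

lemma inverse_max_norm_diff_le:
  fixes Q N c :: real
  assumes N: "N > 0" and c: "c > 0" "c\<^sup>2 = 7 / 8 * N\<^sup>2" and Q: "Q \<ge> 0"
  shows "\<bar>1 / max (sqrt Q) c - 1 / N\<bar> \<le> 5 / 9 * \<bar>Q - N\<^sup>2\<bar> / N ^ 3"
proof -
  define h where "h = max (sqrt Q) c"
  have h: "h \<ge> c" "h > 0" using c by (auto simp: h_def)
  have h2: "h\<^sup>2 = max Q (c\<^sup>2)"
    using Q c(1) real_sqrt_pow2[OF Q] unfolding h_def
    by (metis less_eq_real_def max_def power_mono real_le_lsqrt real_sqrt_ge_zero)
  \<comment> \<open>Raising \<open>Q\<close> to \<open>c^2\<close>, which lies below
    \<open>N^2\<close>, can only bring it closer to \<open>N^2\<close>.\<close>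
  have d: "\<bar>N\<^sup>2 - h\<^sup>2\<bar> \<le> \<bar>Q - N\<^sup>2\<bar>"
    unfolding h2 c(2) using zero_le_power2[of N] by (simp add: max_def abs_if)
  \<comment> \<open>37/40 is a rational lower bound for \<open>sqrt (7/8)\<close>, convenient
    because \<open>37/40 + 7/8 = 9/5\<close>.\<close>
  have cN: "37 / 40 * N \<le> c"
  proof (rule power2_le_imp_le)
    show "(37 / 40 * N)\<^sup>2 \<le> c\<^sup>2" unfolding c(2) power_mult_distrib
      by (intro mult_right_mono) (auto simp: power2_eq_square)
  qed (use c in auto)
  have hN: "9 / 5 * N\<^sup>2 \<le> h * (N + h)"
  proof -
    have "37 / 40 * N * N \<le> h * N" using cN h N by (intro mult_right_mono) auto
    moreover have "7 / 8 * N\<^sup>2 \<le> h * h" using h2 c(2) by (simp add: power2_eq_square)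
    moreover have "N\<^sup>2 \<ge> 0" by simp
    ultimately show ?thesis by (simp add: power2_eq_square algebra_simps)
  qed
  have "N\<^sup>2 - h\<^sup>2 = (N - h) * (N + h)" by (simp add: power2_eq_square algebra_simps)
  then have "1 / h - 1 / N = (N\<^sup>2 - h\<^sup>2) / (N * (h * (N + h)))"
    using N h by (simp add: diff_divide_distrib)
  then have "\<bar>1 / h - 1 / N\<bar> = \<bar>N\<^sup>2 - h\<^sup>2\<bar> / (N * (h * (N + h)))"
    using N h by (simp add: abs_mult)
  also have "\<dots> \<le> \<bar>Q - N\<^sup>2\<bar> / (N * (9 / 5 * N\<^sup>2))"
    using N h d hN by (intro frac_le mult_left_mono mult_pos_pos) auto
  also have "\<dots> = 5 / 9 * \<bar>Q - N\<^sup>2\<bar> / N ^ 3"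
    by (simp add: power2_eq_square power3_eq_cube)
  finally show ?thesis by (simp add: h_def)
qed

context prob_space
begin

text \<open>Only a bound on the moment generating function is assumed of the entries, so that the
  lemma covers both sub-Gaussian columns and Gaussian noise.\<close>

lemma subG_linear_form_mgf:
  fixes x :: "nat \<Rightarrow> 'a \<Rightarrow> real" and u :: "nat \<Rightarrow> real"
  assumes ind: "indep_vars (\<lambda>_. borel) x {..<n}"
    and mgf: "\<And>i l. i < n \<Longrightarrow> (\<integral>\<^sup>+\<omega>. ennreal (exp (l * x i \<omega>)) \<partial>M) \<le> ennreal (exp (B\<^sup>2 * l\<^sup>2 / 2))"
    and u: "(\<Sum>i<n. (u i)\<^sup>2) \<le> 1"
  shows "(\<integral>\<^sup>+\<omega>. ennreal (exp (l * (\<Sum>i<n. u i * x i \<omega>))) \<partial>M) \<le> ennreal (exp (B\<^sup>2 * l\<^sup>2 / 2))"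
proof -
  have "(\<integral>\<^sup>+\<omega>. ennreal (exp (\<Sum>i<n. (l * u i) * x i \<omega>)) \<partial>M) \<le> ennreal (exp (\<Sum>i<n. B\<^sup>2 * (l * u i)\<^sup>2 / 2))"
    by (rule indep_vars_exp_sum_le) (auto intro!: mgf indep_vars_compose2[OF ind])
  also have "(\<lambda>\<omega>. \<Sum>i<n. (l * u i) * x i \<omega>) = (\<lambda>\<omega>. l * (\<Sum>i<n. u i * x i \<omega>))"
    by (simp add: sum_distrib_left mult.assoc)
  also have "(\<Sum>i<n. B\<^sup>2 * (l * u i)\<^sup>2 / 2) = B\<^sup>2 * l\<^sup>2 / 2 * (\<Sum>i<n. (u i)\<^sup>2)"
    by (simp add: sum_distrib_left power_mult_distrib algebra_simps)
  also have "ennreal (exp (B\<^sup>2 * l\<^sup>2 / 2 * (\<Sum>i<n. (u i)\<^sup>2))) \<le> ennreal (exp (B\<^sup>2 * l\<^sup>2 / 2))"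
    using mult_left_mono[OF u, of "B\<^sup>2 * l\<^sup>2 / 2"] by (intro ennreal_leI) simp
  finally show ?thesis .
qed

text \<open>The first part of the exponent is the sub-Gaussian one with the norm replaced by its
  floor \<open>sqrt (7/8 n) s\<close>. The second is the bias of the ratio, caused by the dependence
  between numerator and norm; it is linear in \<open>l\<close> and governed by fourth moments
  through \<open>F\<close>.\<close>

lemma normalized_linear_form_mgf:
  fixes x :: "nat \<Rightarrow> 'a \<Rightarrow> real" and u :: "nat \<Rightarrow> real"
  assumes ind: "indep_vars (\<lambda>_. borel) x {..<n}" and n: "n > 0"
    and sub: "\<And>i. i < n \<Longrightarrow> subG M (x i) B" and B: "B > 0" and s: "s > 0"
    and var: "\<And>i. i < n \<Longrightarrow> (\<integral>\<omega>. (x i \<omega>)\<^sup>2 \<partial>M) = s\<^sup>2"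
    and F: "\<And>i. i < n \<Longrightarrow> (\<integral>\<omega>. x i \<omega> ^ 4 \<partial>M) \<le> F" "F > 0"
    and u: "(\<Sum>i<n. (u i)\<^sup>2) \<le> 1"
  shows "(\<integral>\<^sup>+\<omega>. ennreal (exp (l * ((\<Sum>i<n. u i * x i \<omega>) /
            max (sqrt (\<Sum>i<n. (x i \<omega>)\<^sup>2)) (sqrt (7 / 8 * real n) * s)))) \<partial>M)
      \<le> ennreal (exp (4 / 7 * l\<^sup>2 * B\<^sup>2 / (real n * s\<^sup>2) + \<bar>l\<bar> * (5 / 9 * sqrt F / (real n * s\<^sup>2))))"
proof -
  define c N where "c = sqrt (7 / 8 * real n) * s" and "N = sqrt (real n) * s"
  have N: "N > 0" "N\<^sup>2 = real n * s\<^sup>2" and c: "c > 0" "c\<^sup>2 = 7 / 8 * N\<^sup>2"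
    using n s by (auto simp: N_def c_def power_mult_distrib)
  define S Q where "S \<omega> = (\<Sum>i<n. u i * x i \<omega>)" and "Q \<omega> = (\<Sum>i<n. (x i \<omega>)\<^sup>2)" for \<omega>
  define z W where "z \<omega> = l * (S \<omega> / max (sqrt (Q \<omega>)) c)" and "W \<omega> = (l / c) * S \<omega>" for \<omega>
  have meas[measurable]: "x i \<in> borel_measurable M" if "i < n" for i
    using sub[OF that] by (simp add: subG_def)
  have i4: "integrable M (\<lambda>\<omega>. x i \<omega> ^ 4)" if "i < n" for i
    by (rule subG_integrable_power4[OF sub[OF that] B])
  have i2: "integrable M (\<lambda>\<omega>. (x i \<omega>)\<^sup>2)" if "i < n" for i
    by (rule integrable_square_of_power4[OF i4[OF that] meas[OF that]])
  have i1: "integrable M (x i)" "expectation (x i) = 0" if "i < n" for i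
    using sub[OF that] by (auto simp: subG_def)
  have [measurable]: "S \<in> borel_measurable M" "Q \<in> borel_measurable M"
    unfolding S_def[abs_def] Q_def[abs_def] by measurable
  then have [measurable]: "z \<in> borel_measurable M" "W \<in> borel_measurable M"
    unfolding z_def[abs_def] W_def[abs_def] by measurable
  have S1: "integrable M S" "expectation S = 0"
    unfolding S_def[abs_def] using i1 by (auto simp: integral_sum)
  have S2: "integrable M (\<lambda>\<omega>. (S \<omega>)\<^sup>2)" "(\<integral>\<omega>. (S \<omega>)\<^sup>2 \<partial>M) \<le> s\<^sup>2"
  proof -
    have *: "integrable M (\<lambda>\<omega>. (S \<omega>)\<^sup>2) \<and> (\<integral>\<omega>. (S \<omega>)\<^sup>2 \<partial>M) = (\<Sum>i<n. \<integral>\<omega>. (u i * x i \<omega>)\<^sup>2 \<partial>M)"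
      unfolding S_def
      by (rule indep_vars_sum_square)
        (auto intro!: indep_vars_compose2[OF ind] simp: power_mult_distrib i1 i2)
    then show "integrable M (\<lambda>\<omega>. (S \<omega>)\<^sup>2)" by simp
    have "(\<integral>\<omega>. (S \<omega>)\<^sup>2 \<partial>M) = (\<Sum>i<n. (u i)\<^sup>2) * s\<^sup>2"
      using * by (simp add: power_mult_distrib var sum_distrib_right)
    also have "\<dots> \<le> 1 * s\<^sup>2" by (intro mult_right_mono u) simp
    finally show "(\<integral>\<omega>. (S \<omega>)\<^sup>2 \<partial>M) \<le> s\<^sup>2" by simp
  qed
  have Q2: "integrable M (\<lambda>\<omega>. (Q \<omega> - N\<^sup>2)\<^sup>2)" "(\<integral>\<omega>. (Q \<omega> - N\<^sup>2)\<^sup>2 \<partial>M) \<le> real n * F"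
  proof -
    have Qs: "Q \<omega> - N\<^sup>2 = (\<Sum>i<n. (x i \<omega>)\<^sup>2 - s\<^sup>2)" for \<omega>
      by (simp add: Q_def N(2) sum_subtractf)
    \<comment> \<open>Together with \<open>E x^2 = s^2\<close> this expansion yields
      \<open>E x^4 - s^4\<close>, so the variance of \<open>Q\<close> is at most
      \<open>n F\<close>.\<close>
    have ex: "((x i \<omega>)\<^sup>2 - s\<^sup>2)\<^sup>2 = x i \<omega> ^ 4 - 2 * s\<^sup>2 * (x i \<omega>)\<^sup>2 + s ^ 4" for i \<omega>
      by (simp add: power2_eq_square power4_eq_xxxx algebra_simps)
    have *: "integrable M (\<lambda>\<omega>. (Q \<omega> - N\<^sup>2)\<^sup>2) \<and>
        (\<integral>\<omega>. (Q \<omega> - N\<^sup>2)\<^sup>2 \<partial>M) = (\<Sum>i<n. \<integral>\<omega>. ((x i \<omega>)\<^sup>2 - s\<^sup>2)\<^sup>2 \<partial>M)"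
      unfolding Qs
    proof (rule indep_vars_sum_square)
      show "indep_vars (\<lambda>_. borel) (\<lambda>i \<omega>. (x i \<omega>)\<^sup>2 - s\<^sup>2) {..<n}"
        by (rule indep_vars_compose2[OF ind]) auto
      show "integrable M (\<lambda>\<omega>. ((x i \<omega>)\<^sup>2 - s\<^sup>2)\<^sup>2)" if "i \<in> {..<n}" for i
        unfolding ex using that i4 i2 by auto
      show "expectation (\<lambda>\<omega>. (x i \<omega>)\<^sup>2 - s\<^sup>2) = 0" if "i \<in> {..<n}" for i
        using that i2 var by (simp add: prob_space)
    qed simp
    then show "integrable M (\<lambda>\<omega>. (Q \<omega> - N\<^sup>2)\<^sup>2)" by simp
    have "(\<integral>\<omega>. ((x i \<omega>)\<^sup>2 - s\<^sup>2)\<^sup>2 \<partial>M) \<le> F" if "i < n" for i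
    proof -
      have "(\<integral>\<omega>. ((x i \<omega>)\<^sup>2 - s\<^sup>2)\<^sup>2 \<partial>M) = (\<integral>\<omega>. x i \<omega> ^ 4 \<partial>M) - 2 * s\<^sup>2 * s\<^sup>2 + s ^ 4"
        unfolding ex using that i4 i2 var by (simp add: prob_space)
      also have "\<dots> \<le> (\<integral>\<omega>. x i \<omega> ^ 4 \<partial>M)"
        using s by (simp add: power2_eq_square power4_eq_xxxx)
      finally show ?thesis using F(1)[OF that] by simp
    qed
    then have "(\<Sum>i<n. \<integral>\<omega>. ((x i \<omega>)\<^sup>2 - s\<^sup>2)\<^sup>2 \<partial>M) \<le> (\<Sum>i<n. F)"
      by (intro sum_mono) auto
    then show "(\<integral>\<omega>. (Q \<omega> - N\<^sup>2)\<^sup>2 \<partial>M) \<le> real n * F" using * by simp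
  qed
  have mW: "(\<integral>\<^sup>+\<omega>. ennreal (exp (W \<omega>)) \<partial>M) \<le> ennreal (exp (B\<^sup>2 * (l / c)\<^sup>2 / 2))"
    unfolding W_def S_def using sub by (intro subG_linear_form_mgf ind u) (auto simp: subG_def)
  have iW: "integrable M (\<lambda>\<omega>. exp (W \<omega>))"
    by (rule integrableI_bounded) (use mW in \<open>auto simp: order_le_less_trans\<close>)
  have eW: "(\<integral>\<omega>. exp (W \<omega>) \<partial>M) \<le> exp (B\<^sup>2 * (l / c)\<^sup>2 / 2)"
    using mW by (subst (asm) nn_integral_eq_integral[OF iW]) auto
  have W1: "integrable M W" "expectation W = 0"
    unfolding W_def[abs_def] using S1 by auto
  have zle: "\<bar>z \<omega>\<bar> \<le> \<bar>W \<omega>\<bar>" for \<omega>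
    unfolding z_def W_def using c by (auto simp: abs_mult intro!: frac_le mult_left_mono)
  have iz: "integrable M z"
    by (rule Bochner_Integration.integrable_bound[OF W1(1)]) (use zle in auto)
  have ez: "exp (z \<omega>) \<le> exp (W \<omega>) + z \<omega> - W \<omega>" for \<omega>
  proof -
    have "exp (c / max (sqrt (Q \<omega>)) c * W \<omega>) \<le> exp (W \<omega>) + c / max (sqrt (Q \<omega>)) c * W \<omega> - W \<omega>"
      using c by (intro exp_shrink_le) auto
    moreover have "c / max (sqrt (Q \<omega>)) c * W \<omega> = z \<omega>"
      using c by (simp add: z_def W_def)
    ultimately show ?thesis by simp
  qed
  have iez: "integrable M (\<lambda>\<omega>. exp (z \<omega>))"
    by (rule Bochner_Integration.integrable_bound[of _ "\<lambda>\<omega>. exp (W \<omega>) + z \<omega> - W \<omega>"])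
      (use ez iW iz W1 in \<open>auto intro!: order_trans[OF ez]\<close>)
  \<comment> \<open>Weight for the inequality between arithmetic and geometric means: it balances
    \<open>a s^2\<close> against \<open>n F / a\<close>, both of which then equal
    \<open>N sqrt F\<close>.\<close>
  define a where "a = sqrt (real n * F) / s"
  have a: "a > 0" using n F s by (simp add: a_def)
  have bias: "expectation z \<le> \<bar>l\<bar> * (5 / 9 * sqrt F / (real n * s\<^sup>2))"
  proof -
    let ?b = "\<lambda>\<omega>. \<bar>l\<bar> * (5 / 9 / N ^ 3) * ((a * (S \<omega>)\<^sup>2 + (Q \<omega> - N\<^sup>2)\<^sup>2 / a) / 2)"
    \<comment> \<open>Subtracting \<open>l / N * S\<close>, of mean 0, keeps the expectation and
      produces the small factor \<open>1 / max (sqrt Q) c - 1 / N\<close>.\<close>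
    have "expectation z = (\<integral>\<omega>. z \<omega> - l / N * S \<omega> \<partial>M)" using iz S1 by simp
    also have "\<dots> \<le> (\<integral>\<omega>. ?b \<omega> \<partial>M)"
    proof (rule integral_mono)
      show "integrable M (\<lambda>\<omega>. z \<omega> - l / N * S \<omega>)" using iz S1 by simp
      show "integrable M ?b" using S2 Q2 by simp
      fix \<omega>
      have q: "Q \<omega> \<ge> 0" by (simp add: Q_def sum_nonneg)
      have "z \<omega> - l / N * S \<omega> = l * S \<omega> * (1 / max (sqrt (Q \<omega>)) c - 1 / N)"
        by (simp add: z_def algebra_simps)
      also have "\<dots> \<le> \<bar>l\<bar> * \<bar>S \<omega>\<bar> * \<bar>1 / max (sqrt (Q \<omega>)) c - 1 / N\<bar>"
        by (metis abs_ge_self abs_mult)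
      also have "\<dots> \<le> \<bar>l\<bar> * \<bar>S \<omega>\<bar> * (5 / 9 * \<bar>Q \<omega> - N\<^sup>2\<bar> / N ^ 3)"
        using inverse_max_norm_diff_le[OF N(1) c q] by (intro mult_left_mono) auto
      also have "\<dots> = \<bar>l\<bar> * (5 / 9 / N ^ 3) * (\<bar>S \<omega>\<bar> * \<bar>Q \<omega> - N\<^sup>2\<bar>)" by simp
      also have "\<dots> \<le> ?b \<omega>"
      proof (intro mult_left_mono)
        have "0 \<le> (a * \<bar>S \<omega>\<bar> - \<bar>Q \<omega> - N\<^sup>2\<bar>)\<^sup>2 / (2 * a)" using a by simp
        also have "\<dots> = (a * \<bar>S \<omega>\<bar>\<^sup>2 + \<bar>Q \<omega> - N\<^sup>2\<bar>\<^sup>2 / a) / 2 - \<bar>S \<omega>\<bar> * \<bar>Q \<omega> - N\<^sup>2\<bar>"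
          using a unfolding power2_diff by (simp add: field_simps power2_eq_square)
        finally show "\<bar>S \<omega>\<bar> * \<bar>Q \<omega> - N\<^sup>2\<bar> \<le> (a * (S \<omega>)\<^sup>2 + (Q \<omega> - N\<^sup>2)\<^sup>2 / a) / 2" by simp
      qed (use N in auto)
      finally show "z \<omega> - l / N * S \<omega> \<le> ?b \<omega>" .
    qed
    also have "\<dots> = \<bar>l\<bar> * (5 / 9 / N ^ 3) * ((a * (\<integral>\<omega>. (S \<omega>)\<^sup>2 \<partial>M) + (\<integral>\<omega>. (Q \<omega> - N\<^sup>2)\<^sup>2 \<partial>M) / a) / 2)"
      using S2 Q2 by simp
    also have "\<dots> \<le> \<bar>l\<bar> * (5 / 9 / N ^ 3) * ((a * s\<^sup>2 + (real n * F) / a) / 2)"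
      using S2 Q2 a N by (intro mult_left_mono divide_right_mono add_mono) auto
    also have "(a * s\<^sup>2 + (real n * F) / a) / 2 = N * sqrt F"
    proof -
      have "real n * F = sqrt (real n * F) * sqrt (real n * F)" using F n by simp
      then have "(real n * F) / a = sqrt (real n * F) * s"
        using F n s by (simp add: a_def field_simps)
      moreover have "a * s\<^sup>2 = sqrt (real n * F) * s" using s by (simp add: a_def power2_eq_square)
      ultimately show ?thesis by (simp add: N_def real_sqrt_mult)
    qed
    also have "\<bar>l\<bar> * (5 / 9 / N ^ 3) * (N * sqrt F) = \<bar>l\<bar> * (5 / 9 * sqrt F / N\<^sup>2)"
      using N(1) by (simp add: power2_eq_square power3_eq_cube)
    finally show ?thesis by (simp only: N(2))
  qed
  have "(\<integral>\<omega>. exp (z \<omega>) \<partial>M) \<le> (\<integral>\<omega>. exp (W \<omega>) + z \<omega> - W \<omega> \<partial>M)"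
    using iez iW iz W1 ez by (intro integral_mono) auto
  also have "\<dots> = (\<integral>\<omega>. exp (W \<omega>) \<partial>M) + expectation z" using iW iz W1 by simp
  also have "\<dots> \<le> exp (B\<^sup>2 * (l / c)\<^sup>2 / 2) + \<bar>l\<bar> * (5 / 9 * sqrt F / (real n * s\<^sup>2))"
    using eW bias by (rule add_mono)
  also have "B\<^sup>2 * (l / c)\<^sup>2 / 2 = 4 / 7 * l\<^sup>2 * B\<^sup>2 / (real n * s\<^sup>2)"
    unfolding power_divide c(2) N(2) by (simp add: field_simps)
  \<comment> \<open>The additive bias moves into the exponent by
    \<open>exp v + e <= exp v (1 + e) <= exp (v + e)\<close>, as \<open>exp v >= 1\<close>. In this
    form the bound multiplies over columns.\<close>
  also have "exp (4 / 7 * l\<^sup>2 * B\<^sup>2 / (real n * s\<^sup>2)) + \<bar>l\<bar> * (5 / 9 * sqrt F / (real n * s\<^sup>2))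
      \<le> exp (4 / 7 * l\<^sup>2 * B\<^sup>2 / (real n * s\<^sup>2)) * exp (\<bar>l\<bar> * (5 / 9 * sqrt F / (real n * s\<^sup>2)))"
    (is "exp ?v + ?e \<le> _")
  proof -
    have "?v \<ge> 0" "?e \<ge> 0" using F by auto
    then have "1 * ?e \<le> exp ?v * ?e" by (intro mult_right_mono) auto
    then have "exp ?v + ?e \<le> exp ?v * (1 + ?e)" by (simp add: distrib_left)
    also have "\<dots> \<le> exp ?v * exp ?e" by (intro mult_left_mono exp_ge_add_one_self) auto
    finally show ?thesis .
  qed
  finally have "(\<integral>\<omega>. exp (z \<omega>) \<partial>M) \<le>
    exp (4 / 7 * l\<^sup>2 * B\<^sup>2 / (real n * s\<^sup>2) + \<bar>l\<bar> * (5 / 9 * sqrt F / (real n * s\<^sup>2)))"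
    by (simp add: exp_add)
  then have "(\<integral>\<^sup>+\<omega>. ennreal (exp (z \<omega>)) \<partial>M) \<le>
    ennreal (exp (4 / 7 * l\<^sup>2 * B\<^sup>2 / (real n * s\<^sup>2) + \<bar>l\<bar> * (5 / 9 * sqrt F / (real n * s\<^sup>2))))"
    by (subst nn_integral_eq_integral[OF iez]) auto
  then show ?thesis unfolding z_def S_def Q_def c_def .
qed

end

subsection \<open>Deterministic estimates\<close>

lemma sum_abs_le_sqrt_card:
  fixes f :: "'i \<Rightarrow> real"
  shows "(\<Sum>i\<in>I. \<bar>f i\<bar>) \<le> sqrt (real (card I)) * sqrt (\<Sum>i\<in>I. (f i)\<^sup>2)"
proof -
  have "(\<Sum>i\<in>I. 1 * \<bar>f i\<bar>)\<^sup>2 \<le> (\<Sum>i\<in>I. 1\<^sup>2) * (\<Sum>i\<in>I. \<bar>f i\<bar>\<^sup>2)"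
    by (rule Cauchy_Schwarz_ineq_sum)
  then have "(\<Sum>i\<in>I. \<bar>f i\<bar>)\<^sup>2 \<le> real (card I) * (\<Sum>i\<in>I. (f i)\<^sup>2)" by simp
  then show ?thesis by (simp add: real_le_rsqrt real_sqrt_mult[symmetric])
qed

text \<open>If \<open>i\<close> in \<open>S\<close> is missed, every chosen \<open>j\<close>
  satisfies \<open>\<bar>\<beta> i\<bar> - e <= \<bar>\<beta> j\<bar> + e\<close>. Summed over
  \<open>Sh\<close>, the right side sees at most the mass of \<open>S - {i}\<close>; the absent
  \<open>\<bar>\<beta> i\<bar> > 0\<close> makes the contradiction strict although hypothesis
  \<open>d\<close> is not.\<close>

lemma largest_entries_contain_support:
  fixes w \<beta> :: "nat \<Rightarrow> real" and p :: nat
  defines "S \<equiv> {j. j < p \<and> \<beta> j \<noteq> 0}"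
  assumes close: "\<And>j. j < p \<Longrightarrow> \<bar>w j - \<beta> j\<bar> \<le> e"
    and m: "\<And>i. i \<in> S \<Longrightarrow> m \<le> \<bar>\<beta> i\<bar>" "m > 0"
    and Sh: "Sh \<subseteq> {..<p}" "\<And>i j. i \<in> Sh \<Longrightarrow> j \<in> {..<p} - Sh \<Longrightarrow> \<bar>w j\<bar> \<le> \<bar>w i\<bar>"
    and d: "sqrt (real (card S)) * sqrt (\<Sum>j<p. (\<beta> j)\<^sup>2) \<le> real (card Sh) * (m - 2 * e)"
  shows "S \<subseteq> Sh"
proof (rule ccontr)
  assume "\<not> S \<subseteq> Sh"
  then obtain i where i: "i \<in> S" "i \<notin> Sh" by auto
  have fS: "finite S" "S \<subseteq> {..<p}" by (auto simp: S_def)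
  have fSh: "finite Sh" using Sh(1) finite_subset by auto
  have "real (card Sh) * (\<bar>\<beta> i\<bar> - e) = (\<Sum>j\<in>Sh. \<bar>\<beta> i\<bar> - e)" by simp
  also have "\<dots> \<le> (\<Sum>j\<in>Sh. \<bar>\<beta> j\<bar> + e)"
  proof (rule sum_mono)
    fix j assume j: "j \<in> Sh"
    have "\<bar>w i\<bar> \<le> \<bar>w j\<bar>" using Sh(2)[OF j, of i] i fS by auto
    moreover have "\<bar>w i - \<beta> i\<bar> \<le> e" "\<bar>w j - \<beta> j\<bar> \<le> e" using close i j Sh(1) fS by auto
    ultimately show "\<bar>\<beta> i\<bar> - e \<le> \<bar>\<beta> j\<bar> + e" by linarith
  qed
  also have "\<dots> = (\<Sum>j\<in>Sh. \<bar>\<beta> j\<bar>) + real (card Sh) * e" by (simp add: sum.distrib)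
  also have "(\<Sum>j\<in>Sh. \<bar>\<beta> j\<bar>) = (\<Sum>j\<in>Sh \<inter> S. \<bar>\<beta> j\<bar>)"
    using fSh Sh(1) by (intro sum.mono_neutral_right) (auto simp: S_def)
  also have "\<dots> \<le> (\<Sum>j\<in>S - {i}. \<bar>\<beta> j\<bar>)"
    using fS i by (intro sum_mono2) auto
  also have "\<dots> = (\<Sum>j\<in>S. \<bar>\<beta> j\<bar>) - \<bar>\<beta> i\<bar>"
    using fS i by (simp add: sum_diff1)
  also have "(\<Sum>j\<in>S. \<bar>\<beta> j\<bar>) \<le> sqrt (real (card S)) * sqrt (\<Sum>j\<in>S. (\<beta> j)\<^sup>2)"
    by (rule sum_abs_le_sqrt_card)
  also have "(\<Sum>j\<in>S. (\<beta> j)\<^sup>2) = (\<Sum>j<p. (\<beta> j)\<^sup>2)"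
    by (rule sum.mono_neutral_left) (auto simp: S_def)
  finally have "real (card Sh) * (\<bar>\<beta> i\<bar> - e) \<le>
      sqrt (real (card S)) * sqrt (\<Sum>j<p. (\<beta> j)\<^sup>2) - \<bar>\<beta> i\<bar> + real (card Sh) * e" by simp
  also have "\<dots> \<le> real (card Sh) * (m - 2 * e) - \<bar>\<beta> i\<bar> + real (card Sh) * e"
    using d by simp
  finally have "real (card Sh) * \<bar>\<beta> i\<bar> + \<bar>\<beta> i\<bar> \<le> real (card Sh) * m" by (simp add: algebra_simps)
  moreover have "real (card Sh) * m \<le> real (card Sh) * \<bar>\<beta> i\<bar>"
    using m(1)[OF i(1)] by (intro mult_left_mono) auto
  ultimately show False using m(1)[OF i(1)] m(2) by linarith
qed

text \<open>The bracket is the bound for E x^4 / (b^2 s^2) obtained by truncating at T = 4/3 L, for which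
  exp (- 3/8 T) = 1 / sqrt p.\<close>

lemma kurtosis_budget:
  fixes k n p :: nat and r L :: real
  assumes p: "p \<ge> 2" and L: "L = ln (real p)" and k: "k \<le> p" "k < n"
    and r: "r > 0" "r\<^sup>2 \<le> 8 / 3" and logp: "L \<le> real n / 16 * (r / 4) ^ 4"
  shows "real k * (4 / 3 * L + 2 * (64 / 9 + 4 / 3 * (4 / 3 * L)) * exp (- (3 / 8) * (4 / 3 * L)) / r\<^sup>2)
    \<le> 3 / 2 * real n * L"
proof -
  have "ln 2 \<le> L" unfolding L using p by simp
  then have L23: "2 / 3 \<le> L" using ln2_ge_two_thirds by linarith
  then have Lpos: "L > 0" by simp
  have n: "real n > 0" using k by simp
  define K where "K = 128 / 9 + 32 / 9 * L"
  have K: "K > 0" using Lpos by (simp add: K_def)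
  have r4: "4096 * L \<le> real n * (r\<^sup>2)\<^sup>2"
    using logp by (simp add: power_divide field_simps)
  have r2: "64 * sqrt L \<le> sqrt (real n) * r\<^sup>2"
  proof (rule power2_le_imp_le)
    show "(64 * sqrt L)\<^sup>2 \<le> (sqrt (real n) * r\<^sup>2)\<^sup>2"
      using r4 Lpos by (simp add: power_mult_distrib)
  qed simp
  have ex: "exp (- (3 / 8) * (4 / 3 * L)) = 1 / sqrt (real p)"
  proof -
    have "- (3 / 8) * (4 / 3 * L) = - (L / 2)" by simp
    moreover have "exp (L / 2) = sqrt (real p)"
    proof -
      have "(exp (L / 2))\<^sup>2 = real p" using p by (simp add: exp_double[symmetric] L)
      then show ?thesis by (metis exp_ge_zero real_sqrt_unique)
    qed
    ultimately show ?thesis by (simp only: exp_minus inverse_eq_divide)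
  qed
  have tail: "real k * (1 / sqrt (real p) / r\<^sup>2) \<le> real n / (64 * sqrt L)"
  proof -
    \<comment> \<open>\<open>k <= min n p\<close> enters as a geometric mean: \<open>sqrt p\<close>
      cancels the truncation error \<open>1 / sqrt p\<close>, and \<open>sqrt n\<close> joins
      \<open>r2\<close>, which trades \<open>1 / r^2\<close> for
      \<open>sqrt n / (64 sqrt L)\<close>.\<close>
    have "real k = sqrt (real k) * sqrt (real k)" by simp
    also have "\<dots> \<le> sqrt (real n) * sqrt (real p)" using k by (intro mult_mono) auto
    finally have "real k \<le> sqrt (real n) * sqrt (real p)" .
    from mult_mono[OF this r2]
    have "real k * (64 * sqrt L) \<le> (sqrt (real n) * sqrt (real p)) * (sqrt (real n) * r\<^sup>2)"
      using Lpos by simp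
    also have "\<dots> = real n * (sqrt (real p) * r\<^sup>2)" by simp
    finally show ?thesis using Lpos r p by (simp add: field_simps)
  qed
  have "real k * (4 / 3 * L + 2 * (64 / 9 + 4 / 3 * (4 / 3 * L)) * exp (- (3 / 8) * (4 / 3 * L)) / r\<^sup>2)
      = 4 / 3 * real k * L + K * (real k * (1 / sqrt (real p) / r\<^sup>2))"
    unfolding ex K_def by (simp add: algebra_simps add_divide_distrib)
  also have "\<dots> \<le> 4 / 3 * real k * L + K * (real n / (64 * sqrt L))"
    using tail K by (intro add_left_mono mult_left_mono) auto
  also have "\<dots> \<le> 3 / 2 * real n * L"
  proof (cases "L \<ge> 2")
    case True
    \<comment> \<open>For \<open>L >= 2\<close> the tail costs at most \<open>n L / 6\<close>, the
      difference between 3/2 and 4/3.\<close>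
    have "1 \<le> sqrt L" using True by simp
    then have "32 / 3 * L * 1 \<le> 32 / 3 * L * sqrt L" using Lpos by (intro mult_left_mono) auto
    moreover have "K \<le> 32 / 3 * L" using True by (simp add: K_def)
    ultimately have "K \<le> 1 / 6 * L * (64 * sqrt L)" by simp
    then have "K / (64 * sqrt L) \<le> 1 / 6 * L" using Lpos by (subst pos_divide_le_eq) auto
    then have "K / (64 * sqrt L) * real n \<le> 1 / 6 * L * real n" by (intro mult_right_mono) auto
    moreover have "real k * L \<le> real n * L" using k Lpos by (intro mult_right_mono) auto
    ultimately show ?thesis by (simp add: algebra_simps)
  next
    case False
    \<comment> \<open>For \<open>L < 2\<close> there are at most 8 support indices, while
      \<open>logp\<close> and \<open>r^2 <= 8/3\<close> force \<open>n >= 384\<close>. The main term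
      is then below \<open>n L / 10\<close>, which leaves 7/5 for the tail.\<close>
    have "real p = exp L" using p by (simp add: L)
    also have "\<dots> \<le> exp 2" using False by simp
    also have "exp (2::real) = (exp 1)\<^sup>2" by (simp add: exp_double[symmetric])
    also have "\<dots> \<le> (272 / 100)\<^sup>2" using e_less_272 by (intro power_mono) auto
    also have "\<dots> \<le> 8" by (simp add: power2_eq_square)
    finally have k8: "real k \<le> 8" using k by linarith
    have "(r\<^sup>2)\<^sup>2 \<le> (8 / 3)\<^sup>2" using r by (intro power_mono) auto
    then have "4096 * L \<le> real n * (8 / 3)\<^sup>2" using r4 n by (smt (verit) mult_left_mono)
    then have n384: "real n \<ge> 384" using L23 by (simp add: power2_eq_square)
    have "real k * L \<le> 8 * L" using k8 Lpos by (intro mult_right_mono) auto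
    moreover have "384 * L \<le> real n * L" using n384 Lpos by (intro mult_right_mono) auto
    moreover have "K * (real n / (64 * sqrt L)) \<le> 7 / 5 * (real n * L)"
    proof -
      have "4 / 5 \<le> sqrt L" using L23 by (intro real_le_rsqrt) (simp add: power2_eq_square)
      then have "448 / 5 * L * (4 / 5) \<le> 448 / 5 * L * sqrt L" using Lpos by (intro mult_left_mono) auto
      moreover have "K \<le> 448 / 5 * L * (4 / 5)" using L23 by (simp add: K_def)
      ultimately have "K \<le> 7 / 5 * L * (64 * sqrt L)" by linarith
      then have "K / (64 * sqrt L) \<le> 7 / 5 * L" using Lpos by (subst pos_divide_le_eq) auto
      then have "K / (64 * sqrt L) * real n \<le> 7 / 5 * L * real n" by (intro mult_right_mono) auto
      then show ?thesis by (simp add: mult_ac)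
    qed
    ultimately have "4 / 3 * (real k * L) + K * (real n / (64 * sqrt L)) \<le> 3 / 2 * (real n * L)"
      using Lpos by linarith
    then show ?thesis by (simp only: mult.assoc)
  qed
  finally show ?thesis .
qed

text \<open>The exponents add up to 128/63 + 35/27 - 16/3 < - 2 times L; the factor 2/3 in the choice of l is
  close to optimal.\<close>

lemma chernoff_exponent_le:
  fixes k n :: nat and \<beta> b s :: "nat \<Rightarrow> real" and A r L Y l :: real
  assumes J: "finite J" "card J \<le> k" and A: "A > 0" "(\<Sum>j\<in>J. (\<beta> j)\<^sup>2) \<le> A\<^sup>2"
    and n: "n > 0" and r: "r > 0" and L: "L > 0" and Y: "Y \<ge> 0" "real k * Y \<le> 3 / 2 * real n * L"
    and b: "\<And>j. j \<in> J \<Longrightarrow> b j > 0" and s: "\<And>j. j \<in> J \<Longrightarrow> s j > 0"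
    and rj: "\<And>j. j \<in> J \<Longrightarrow> r \<le> s j / b j"
    and l: "\<bar>l\<bar> = 2 / 3 * sqrt (8 * L * real n) * r / A"
  shows "(\<Sum>j\<in>J. 4 / 7 * (l * \<beta> j)\<^sup>2 * (b j)\<^sup>2 / (real n * (s j)\<^sup>2)
      + \<bar>l * \<beta> j\<bar> * (5 / 9 * sqrt ((b j)\<^sup>2 * (s j)\<^sup>2 * Y) / (real n * (s j)\<^sup>2)))
    - \<bar>l\<bar> * (sqrt (8 * L / real n) / r * A) \<le> - 2 * L"
proof -
  have bs: "b j / s j \<le> 1 / r" "0 \<le> b j / s j" if "j \<in> J" for j
    using rj[OF that] b[OF that] s[OF that] r by (auto simp: field_simps)
  have "(\<Sum>j\<in>J. 4 / 7 * (l * \<beta> j)\<^sup>2 * (b j)\<^sup>2 / (real n * (s j)\<^sup>2)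
      + \<bar>l * \<beta> j\<bar> * (5 / 9 * sqrt ((b j)\<^sup>2 * (s j)\<^sup>2 * Y) / (real n * (s j)\<^sup>2)))
    \<le> (\<Sum>j\<in>J. 4 / 7 * l\<^sup>2 / (real n * r\<^sup>2) * (\<beta> j)\<^sup>2 + 5 / 9 * \<bar>l\<bar> * sqrt Y / (real n * r) * \<bar>\<beta> j\<bar>)"
  proof (intro sum_mono add_mono)
    fix j assume j: "j \<in> J"
    have "4 / 7 * (l * \<beta> j)\<^sup>2 * (b j)\<^sup>2 / (real n * (s j)\<^sup>2) = 4 / 7 * l\<^sup>2 * (\<beta> j)\<^sup>2 / real n * (b j / s j)\<^sup>2"
      by (simp add: power_mult_distrib power_divide)
    also have "\<dots> \<le> 4 / 7 * l\<^sup>2 * (\<beta> j)\<^sup>2 / real n * (1 / r)\<^sup>2"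
      using bs[OF j] by (intro mult_left_mono power_mono) auto
    finally show "4 / 7 * (l * \<beta> j)\<^sup>2 * (b j)\<^sup>2 / (real n * (s j)\<^sup>2) \<le> 4 / 7 * l\<^sup>2 / (real n * r\<^sup>2) * (\<beta> j)\<^sup>2"
      by (simp add: power_divide mult_ac)
    have "\<bar>l * \<beta> j\<bar> * (5 / 9 * sqrt ((b j)\<^sup>2 * (s j)\<^sup>2 * Y) / (real n * (s j)\<^sup>2))
        = 5 / 9 * \<bar>l\<bar> * \<bar>\<beta> j\<bar> * sqrt Y / real n * (b j / s j)"
      using b[OF j] s[OF j] by (simp add: real_sqrt_mult abs_mult power2_eq_square mult_ac)
    also have "\<dots> \<le> 5 / 9 * \<bar>l\<bar> * \<bar>\<beta> j\<bar> * sqrt Y / real n * (1 / r)"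
      using bs[OF j] Y by (intro mult_left_mono) auto
    finally show "\<bar>l * \<beta> j\<bar> * (5 / 9 * sqrt ((b j)\<^sup>2 * (s j)\<^sup>2 * Y) / (real n * (s j)\<^sup>2))
        \<le> 5 / 9 * \<bar>l\<bar> * sqrt Y / (real n * r) * \<bar>\<beta> j\<bar>"
      by (simp add: mult_ac)
  qed
  also have "\<dots> = 4 / 7 * l\<^sup>2 / (real n * r\<^sup>2) * (\<Sum>j\<in>J. (\<beta> j)\<^sup>2) + 5 / 9 * \<bar>l\<bar> * sqrt Y / (real n * r) * (\<Sum>j\<in>J. \<bar>\<beta> j\<bar>)"
    by (simp only: sum.distrib sum_distrib_left)
  also have "\<dots> \<le> 4 / 7 * l\<^sup>2 / (real n * r\<^sup>2) * A\<^sup>2 + 5 / 9 * \<bar>l\<bar> * sqrt Y / (real n * r) * (sqrt (real k) * A)"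
  proof (intro add_mono mult_left_mono A(2))
    \<comment> \<open>The bias is linear in the coefficients, so passing to the Euclidean norm costs
      \<open>sqrt k\<close>; this is why the product \<open>k * Y\<close> has to be bounded.\<close>
    have "(\<Sum>j\<in>J. \<bar>\<beta> j\<bar>) \<le> sqrt (real (card J)) * sqrt (\<Sum>j\<in>J. (\<beta> j)\<^sup>2)"
      by (rule sum_abs_le_sqrt_card)
    also have "\<dots> \<le> sqrt (real k) * A"
      using J A by (intro mult_mono real_le_lsqrt) (auto simp: sum_nonneg)
    finally show "(\<Sum>j\<in>J. \<bar>\<beta> j\<bar>) \<le> sqrt (real k) * A" .
  qed (use n r Y in auto)
  also have "4 / 7 * l\<^sup>2 / (real n * r\<^sup>2) * A\<^sup>2 = 128 / 63 * L"
  proof -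
    have "l\<^sup>2 = \<bar>l\<bar>\<^sup>2" by simp
    also have "\<dots> = 32 / 9 * L * real n * r\<^sup>2 / A\<^sup>2"
      unfolding l using L n by (simp add: power_divide power_mult_distrib)
    finally show ?thesis using n r A by simp
  qed
  also have "5 / 9 * \<bar>l\<bar> * sqrt Y / (real n * r) * (sqrt (real k) * A) \<le> 10 / 27 * (7 / 2 * L)"
  proof -
    have "5 / 9 * \<bar>l\<bar> * sqrt Y / (real n * r) * (sqrt (real k) * A)
        = 10 / 27 * (sqrt (8 * L * real n) * sqrt (real k * Y) / real n)"
      unfolding l using n r A by (simp add: real_sqrt_mult)
    also have "\<dots> \<le> 10 / 27 * (7 / 2 * L)"
    proof (intro mult_left_mono)
      \<comment> \<open>\<open>8 * 3/2 = 12\<close>, and 7/2 is a rational upper bound for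
        \<open>sqrt 12\<close>. With the prefactor \<open>5/9 * 2/3 = 10/27\<close> the bias
        contributes \<open>35/27 L\<close>.\<close>
      have "sqrt (8 * L * real n) * sqrt (real k * Y) \<le> sqrt (8 * L * real n) * sqrt (3 / 2 * real n * L)"
        using Y L n by (intro mult_left_mono) auto
      also have "\<dots> = sqrt (12 * (L * real n)\<^sup>2)"
        unfolding real_sqrt_mult[symmetric] by (simp add: power2_eq_square mult_ac)
      also have "\<dots> = sqrt 12 * (L * real n)"
        using L n by (simp add: real_sqrt_mult)
      also have "\<dots> \<le> 7 / 2 * (L * real n)"
        using L n by (intro mult_right_mono real_le_lsqrt) (auto simp: power2_eq_square)
      finally show "sqrt (8 * L * real n) * sqrt (real k * Y) / real n \<le> 7 / 2 * L"
        using n by (simp add: pos_divide_le_eq)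
    qed simp
    finally show ?thesis .
  qed
  finally have "(\<Sum>j\<in>J. 4 / 7 * (l * \<beta> j)\<^sup>2 * (b j)\<^sup>2 / (real n * (s j)\<^sup>2)
      + \<bar>l * \<beta> j\<bar> * (5 / 9 * sqrt ((b j)\<^sup>2 * (s j)\<^sup>2 * Y) / (real n * (s j)\<^sup>2)))
    \<le> 128 / 63 * L + 10 / 27 * (7 / 2 * L)" by simp
  moreover have "\<bar>l\<bar> * (sqrt (8 * L / real n) / r * A) = 16 / 3 * L"
    unfolding l using n r A L by (simp add: real_sqrt_mult real_sqrt_divide)
  ultimately show ?thesis using L by simp
qed

subsection \<open>Correlations with a random column\<close>

text \<open>Equality fails only for a zero column, which division by zero normalizes to zero. The
  inequality covers both cases, so any value of the column may be frozen as a direction.\<close>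

lemma sum_normalize_cols_square_le: "(\<Sum>i<n. (normalize_cols n A i j)\<^sup>2) \<le> 1"
proof -
  have "(\<Sum>i<n. (normalize_cols n A i j)\<^sup>2) = (\<Sum>i<n. (A i j)\<^sup>2) / (col_norm n A j)\<^sup>2"
    by (simp add: normalize_cols_def power_divide sum_divide_distrib)
  also have "(col_norm n A j)\<^sup>2 = (\<Sum>i<n. (A i j)\<^sup>2)"
    by (simp add: col_norm_def sum_nonneg)
  finally show ?thesis by simp
qed

context prob_space
begin

text \<open>The singletons \<open>{f j}\<close> are disjoint blocks by injectivity, and restrictions
  of an independent family to disjoint blocks are independent.\<close>

lemma indep_vars_reindex:
  assumes ind: "indep_vars (\<lambda>_. N) X I" and f: "inj_on f J" "f ` J \<subseteq> I"
  shows "indep_vars (\<lambda>_. N) (\<lambda>j. X (f j)) J"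
proof -
  have "indep_vars (\<lambda>j. PiM {f j} (\<lambda>_. N)) (\<lambda>j \<omega>. restrict (\<lambda>i. X i \<omega>) {f j}) J"
    using f by (intro indep_vars_restrict[OF ind]) (auto simp: disjoint_family_on_def inj_on_def)
  then have "indep_vars (\<lambda>_. N) (\<lambda>j \<omega>. (\<lambda>g. g (f j)) (restrict (\<lambda>i. X i \<omega>) {f j})) J"
    by (rule indep_vars_compose2) auto
  then show ?thesis by simp
qed

text \<open>For a fixed direction \<open>u\<close>, each summand is a function of the block
  \<open>{..<n} \<times> {m}\<close> alone. The blocks are disjoint, so the single-column bounds
  multiply.\<close>

lemma normalized_columns_mgf:
  fixes V :: "nat \<Rightarrow> nat \<Rightarrow> 'a \<Rightarrow> real" and u :: "nat \<Rightarrow> real"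
  assumes ind: "indep_vars (\<lambda>_. borel) (\<lambda>z. V (fst z) (snd z)) ({..<n} \<times> J)"
    and J: "finite J" and n: "n > 0"
    and b: "\<And>m. m \<in> J \<Longrightarrow> b m > 0" and s: "\<And>m. m \<in> J \<Longrightarrow> s m > 0"
    and F: "\<And>m. m \<in> J \<Longrightarrow> F m > 0"
    and sub: "\<And>i m. i < n \<Longrightarrow> m \<in> J \<Longrightarrow> subG M (V i m) (b m)"
    and var: "\<And>i m. i < n \<Longrightarrow> m \<in> J \<Longrightarrow> (\<integral>\<omega>. (V i m \<omega>)\<^sup>2 \<partial>M) = (s m)\<^sup>2"
    and F4: "\<And>i m. i < n \<Longrightarrow> m \<in> J \<Longrightarrow> (\<integral>\<omega>. V i m \<omega> ^ 4 \<partial>M) \<le> F m"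
    and u: "(\<Sum>i<n. (u i)\<^sup>2) \<le> 1"
  shows "(\<integral>\<^sup>+\<omega>. ennreal (exp (\<Sum>m\<in>J. l * \<beta> m * ((\<Sum>i<n. u i * V i m \<omega>) /
            max (sqrt (\<Sum>i<n. (V i m \<omega>)\<^sup>2)) (sqrt (7 / 8 * real n) * s m)))) \<partial>M)
      \<le> ennreal (exp (\<Sum>m\<in>J. 4 / 7 * (l * \<beta> m)\<^sup>2 * (b m)\<^sup>2 / (real n * (s m)\<^sup>2)
            + \<bar>l * \<beta> m\<bar> * (5 / 9 * sqrt (F m) / (real n * (s m)\<^sup>2))))"
proof (rule indep_vars_exp_sum_le[OF J])
  let ?Y = "\<lambda>m g. l * \<beta> m * ((\<Sum>i<n. u i * g (i, m)) /
            max (sqrt (\<Sum>i<n. (g (i, m))\<^sup>2)) (sqrt (7 / 8 * real n) * s m))"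
  have "indep_vars (\<lambda>m. PiM ({..<n} \<times> {m}) (\<lambda>_. borel))
      (\<lambda>m \<omega>. restrict (\<lambda>z. V (fst z) (snd z) \<omega>) ({..<n} \<times> {m})) J"
    by (intro indep_vars_restrict[OF ind]) (auto simp: disjoint_family_on_def)
  then have "indep_vars (\<lambda>_. borel)
      (\<lambda>m \<omega>. ?Y m (restrict (\<lambda>z. V (fst z) (snd z) \<omega>) ({..<n} \<times> {m}))) J"
  proof (rule indep_vars_compose2)
    fix m :: nat
    have [measurable]: "(\<lambda>g. g (i, m)) \<in> borel_measurable (PiM ({..<n} \<times> {m}) (\<lambda>_. borel :: real measure))"
      if "i < n" for i
      using that by (intro measurable_component_singleton) auto
    show "?Y m \<in> borel_measurable (PiM ({..<n} \<times> {m}) (\<lambda>_. borel))"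
      by measurable
  qed
  then show "indep_vars (\<lambda>_. borel) (\<lambda>m \<omega>. l * \<beta> m * ((\<Sum>i<n. u i * V i m \<omega>) /
            max (sqrt (\<Sum>i<n. (V i m \<omega>)\<^sup>2)) (sqrt (7 / 8 * real n) * s m))) J"
    by simp
next
  fix m assume m: "m \<in> J"
  have col: "indep_vars (\<lambda>_. borel) (\<lambda>i. V i m) {..<n}"
    using indep_vars_reindex[OF ind, of "\<lambda>i. (i, m)" "{..<n}"] m by (auto simp: inj_on_def)
  show "(\<integral>\<^sup>+\<omega>. ennreal (exp (l * \<beta> m * ((\<Sum>i<n. u i * V i m \<omega>) /
            max (sqrt (\<Sum>i<n. (V i m \<omega>)\<^sup>2)) (sqrt (7 / 8 * real n) * s m)))) \<partial>M)
      \<le> ennreal (exp (4 / 7 * (l * \<beta> m)\<^sup>2 * (b m)\<^sup>2 / (real n * (s m)\<^sup>2)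
            + \<bar>l * \<beta> m\<bar> * (5 / 9 * sqrt (F m) / (real n * (s m)\<^sup>2))))"
    using m b s F sub var F4 by (intro normalized_linear_form_mgf col n u) auto
qed

text \<open>Column \<open>j\<close> is frozen as the direction \<open>u\<close>. Because
  \<open>j\<close> is outside \<open>J\<close> it is independent of the columns summed over, and the
  bound for fixed \<open>u\<close> does not depend on \<open>u\<close>.\<close>

lemma cross_term_mgf:
  fixes V :: "nat \<Rightarrow> nat \<Rightarrow> 'a \<Rightarrow> real"
  assumes ind: "indep_vars (\<lambda>_. borel) (\<lambda>z. V (fst z) (snd z)) ({..<n} \<times> insert j J)"
    and j: "j \<notin> J"
    and J: "finite J" and n: "n > 0"
    and b: "\<And>m. m \<in> J \<Longrightarrow> b m > 0" and s: "\<And>m. m \<in> J \<Longrightarrow> s m > 0"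
    and F: "\<And>m. m \<in> J \<Longrightarrow> F m > 0"
    and sub: "\<And>i m. i < n \<Longrightarrow> m \<in> J \<Longrightarrow> subG M (V i m) (b m)"
    and var: "\<And>i m. i < n \<Longrightarrow> m \<in> J \<Longrightarrow> (\<integral>\<omega>. (V i m \<omega>)\<^sup>2 \<partial>M) = (s m)\<^sup>2"
    and F4: "\<And>i m. i < n \<Longrightarrow> m \<in> J \<Longrightarrow> (\<integral>\<omega>. V i m \<omega> ^ 4 \<partial>M) \<le> F m"
  shows "(\<integral>\<^sup>+\<omega>. ennreal (exp (l * (\<Sum>m\<in>J. \<beta> m *
            ((\<Sum>i<n. normalize_cols n (\<lambda>i j. V i j \<omega>) i j * V i m \<omega>) /
             max (col_norm n (\<lambda>i j. V i j \<omega>) m) (sqrt (7 / 8 * real n) * s m))))) \<partial>M)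
      \<le> ennreal (exp (\<Sum>m\<in>J. 4 / 7 * (l * \<beta> m)\<^sup>2 * (b m)\<^sup>2 / (real n * (s m)\<^sup>2)
            + \<bar>l * \<beta> m\<bar> * (5 / 9 * sqrt (F m) / (real n * (s m)\<^sup>2))))"
proof -
  let ?A = "{..<n} \<times> {j}" and ?B = "{..<n} \<times> J"
  let ?R = "\<lambda>K \<omega>. restrict (\<lambda>z. V (fst z) (snd z) \<omega>) K"
  define f where "f x y = ennreal (exp (\<Sum>m\<in>J. l * \<beta> m *
      ((\<Sum>i<n. normalize_cols n (curry x) i j * y (i, m)) /
       max (sqrt (\<Sum>i<n. (y (i, m))\<^sup>2)) (sqrt (7 / 8 * real n) * s m))))"
    for x y :: "nat \<times> nat \<Rightarrow> real"
  have iv: "indep_var (PiM ?A (\<lambda>_. borel)) (?R ?A) (PiM ?B (\<lambda>_. borel)) (?R ?B)"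
    using j by (intro indep_var_restrict[OF ind]) auto
  have "(\<integral>\<^sup>+\<omega>. f (?R ?A \<omega>) (?R ?B \<omega>) \<partial>M)
      \<le> ennreal (exp (\<Sum>m\<in>J. 4 / 7 * (l * \<beta> m)\<^sup>2 * (b m)\<^sup>2 / (real n * (s m)\<^sup>2)
            + \<bar>l * \<beta> m\<bar> * (5 / 9 * sqrt (F m) / (real n * (s m)\<^sup>2))))"
  proof (rule indep_var_nn_integral_le[OF iv])
    have [measurable]: "(\<lambda>g. fst g (i, j)) \<in> borel_measurable
        (PiM ?A (\<lambda>_. borel :: real measure) \<Otimes>\<^sub>M PiM ?B (\<lambda>_. borel :: real measure))" if "i < n" for i
      using that by (intro measurable_compose[OF measurable_fst measurable_component_singleton]) auto
    have [measurable]: "(\<lambda>g. snd g (i, m)) \<in> borel_measurable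
        (PiM ?A (\<lambda>_. borel :: real measure) \<Otimes>\<^sub>M PiM ?B (\<lambda>_. borel :: real measure))" if "i < n" "m \<in> J" for i m
      using that by (intro measurable_compose[OF measurable_snd measurable_component_singleton]) auto
    show "(\<lambda>(x, y). f x y) \<in> borel_measurable (PiM ?A (\<lambda>_. borel) \<Otimes>\<^sub>M PiM ?B (\<lambda>_. borel))"
      unfolding f_def case_prod_beta normalize_cols_def col_norm_def curry_def by measurable
  next
    fix x :: "nat \<times> nat \<Rightarrow> real"
    have "(\<integral>\<^sup>+\<omega>. f x (?R ?B \<omega>) \<partial>M) = (\<integral>\<^sup>+\<omega>. ennreal (exp (\<Sum>m\<in>J. l * \<beta> m *
      ((\<Sum>i<n. normalize_cols n (curry x) i j * V i m \<omega>) /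
       max (sqrt (\<Sum>i<n. (V i m \<omega>)\<^sup>2)) (sqrt (7 / 8 * real n) * s m)))) \<partial>M)"
      unfolding f_def by (intro nn_integral_cong arg_cong[where f = ennreal] arg_cong[where f = exp] sum.cong) auto
    also have "\<dots> \<le> ennreal (exp (\<Sum>m\<in>J. 4 / 7 * (l * \<beta> m)\<^sup>2 * (b m)\<^sup>2 / (real n * (s m)\<^sup>2)
            + \<bar>l * \<beta> m\<bar> * (5 / 9 * sqrt (F m) / (real n * (s m)\<^sup>2))))"
      by (rule normalized_columns_mgf[OF indep_vars_subset[OF ind] J n b s F sub var F4])
        (auto intro: sum_normalize_cols_square_le)
    finally show "(\<integral>\<^sup>+\<omega>. f x (?R ?B \<omega>) \<partial>M)
      \<le> ennreal (exp (\<Sum>m\<in>J. 4 / 7 * (l * \<beta> m)\<^sup>2 * (b m)\<^sup>2 / (real n * (s m)\<^sup>2)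
            + \<bar>l * \<beta> m\<bar> * (5 / 9 * sqrt (F m) / (real n * (s m)\<^sup>2))))" .
  qed
  also have "(\<lambda>\<omega>. f (?R ?A \<omega>) (?R ?B \<omega>)) = (\<lambda>\<omega>. ennreal (exp (l * (\<Sum>m\<in>J. \<beta> m *
            ((\<Sum>i<n. normalize_cols n (\<lambda>i j. V i j \<omega>) i j * V i m \<omega>) /
             max (col_norm n (\<lambda>i j. V i j \<omega>) m) (sqrt (7 / 8 * real n) * s m))))))"
    unfolding f_def sum_distrib_left
    by (intro ext arg_cong[where f = ennreal] arg_cong[where f = exp] sum.cong)
      (auto simp: normalize_cols_def col_norm_def curry_def)
  finally show ?thesis .
qed

text \<open>The same conditioning with the noise as the free variable: given column
  \<open>j\<close>, the term is a linear form in \<open>\<eta>\<close> with weights of norm at most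
  1.\<close>

lemma noise_term_mgf:
  fixes V :: "nat \<Rightarrow> nat \<Rightarrow> 'a \<Rightarrow> real"
  assumes ind: "indep_vars (\<lambda>_. borel) (\<lambda>z. case z of Inl (i, j) \<Rightarrow> V i j | Inr i \<Rightarrow> \<eta> i)
      (({..<n} \<times> {..<p}) <+> {..<n})"
    and j: "j < p"
    and mgf: "\<And>i l. i < n \<Longrightarrow> (\<integral>\<^sup>+\<omega>. ennreal (exp (l * \<eta> i \<omega>)) \<partial>M) \<le> ennreal (exp (\<sigma>\<^sup>2 * l\<^sup>2 / 2))"
  shows "(\<integral>\<^sup>+\<omega>. ennreal (exp (l * (\<Sum>i<n. normalize_cols n (\<lambda>i j. V i j \<omega>) i j * \<eta> i \<omega>))) \<partial>M)
      \<le> ennreal (exp (\<sigma>\<^sup>2 * l\<^sup>2 / 2))"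
proof -
  let ?Z = "\<lambda>z. case z of Inl (i, j) \<Rightarrow> V i j | Inr i \<Rightarrow> \<eta> i"
  let ?A = "Inl ` ({..<n} \<times> {j}) :: (nat \<times> nat + nat) set" and ?B = "Inr ` {..<n} :: (nat \<times> nat + nat) set"
  let ?R = "\<lambda>K \<omega>. restrict (\<lambda>z. ?Z z \<omega>) K"
  define f where "f x y = ennreal (exp (l *
      (\<Sum>i<n. normalize_cols n (\<lambda>i j. x (Inl (i, j))) i j * y (Inr i))))"
    for x y :: "(nat \<times> nat + nat) \<Rightarrow> real"
  have iv: "indep_var (PiM ?A (\<lambda>_. borel)) (?R ?A) (PiM ?B (\<lambda>_. borel)) (?R ?B)"
    using j by (intro indep_var_restrict[OF ind]) auto
  have noise: "indep_vars (\<lambda>_. borel) \<eta> {..<n}"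
    using indep_vars_reindex[OF ind, of Inr "{..<n}"] by (auto simp: inj_on_def)
  have "(\<integral>\<^sup>+\<omega>. f (?R ?A \<omega>) (?R ?B \<omega>) \<partial>M) \<le> ennreal (exp (\<sigma>\<^sup>2 * l\<^sup>2 / 2))"
  proof (rule indep_var_nn_integral_le[OF iv])
    have [measurable]: "(\<lambda>g. fst g (Inl (i, j))) \<in> borel_measurable
        (PiM ?A (\<lambda>_. borel :: real measure) \<Otimes>\<^sub>M PiM ?B (\<lambda>_. borel :: real measure))" if "i < n" for i
      using that by (intro measurable_compose[OF measurable_fst measurable_component_singleton]) auto
    have [measurable]: "(\<lambda>g. snd g (Inr i)) \<in> borel_measurable
        (PiM ?A (\<lambda>_. borel :: real measure) \<Otimes>\<^sub>M PiM ?B (\<lambda>_. borel :: real measure))" if "i < n" for i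
      using that by (intro measurable_compose[OF measurable_snd measurable_component_singleton]) auto
    show "(\<lambda>(x, y). f x y) \<in> borel_measurable (PiM ?A (\<lambda>_. borel) \<Otimes>\<^sub>M PiM ?B (\<lambda>_. borel))"
      unfolding f_def case_prod_beta normalize_cols_def col_norm_def by measurable
  next
    fix x :: "(nat \<times> nat + nat) \<Rightarrow> real"
    have "(\<integral>\<^sup>+\<omega>. f x (?R ?B \<omega>) \<partial>M) = (\<integral>\<^sup>+\<omega>. ennreal (exp (l *
        (\<Sum>i<n. normalize_cols n (\<lambda>i j. x (Inl (i, j))) i j * \<eta> i \<omega>))) \<partial>M)"
      unfolding f_def by simp
    also have "\<dots> \<le> ennreal (exp (\<sigma>\<^sup>2 * l\<^sup>2 / 2))"
      by (intro subG_linear_form_mgf noise mgf sum_normalize_cols_square_le)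
    finally show "(\<integral>\<^sup>+\<omega>. f x (?R ?B \<omega>) \<partial>M) \<le> ennreal (exp (\<sigma>\<^sup>2 * l\<^sup>2 / 2))" .
  qed
  also have "(\<lambda>\<omega>. f (?R ?A \<omega>) (?R ?B \<omega>)) =
      (\<lambda>\<omega>. ennreal (exp (l * (\<Sum>i<n. normalize_cols n (\<lambda>i j. V i j \<omega>) i j * \<eta> i \<omega>))))"
    unfolding f_def by (simp add: normalize_cols_def col_norm_def image_iff)
  finally show ?thesis .
qed

lemma gaussian_mgf:
  assumes "distributed M lborel Z (normal_density 0 \<sigma>)" and "\<sigma> > 0"
  shows "(\<integral>\<^sup>+\<omega>. ennreal (exp (l * Z \<omega>)) \<partial>M) = ennreal (exp (\<sigma>\<^sup>2 * l\<^sup>2 / 2))"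
proof -
  have "(\<integral>\<^sup>+\<omega>. ennreal (exp (l * Z \<omega>)) \<partial>M) =
      (\<integral>\<^sup>+x. ennreal (normal_density 0 \<sigma> x) * ennreal (exp (l * x)) \<partial>lborel)"
    using distributed_nn_integral[OF assms(1), of "\<lambda>x. ennreal (exp (l * x))"] by simp
  also have "\<dots> = (\<integral>\<^sup>+x. ennreal (normal_density 0 \<sigma> x * exp (x * l)) \<partial>lborel)"
    by (simp add: ennreal_mult mult.commute)
  finally show ?thesis using assms(2) by (simp add: normal_mgf)
qed

end

text \<open>The diagonal term is exactly \<open>\<beta> j\<close>: for \<open>j\<close> in
  \<open>S\<close> the normalized column has norm 1, and otherwise \<open>\<beta> j = 0\<close>.
  Hence nonzero norms are asked for on \<open>S\<close> only.\<close>

lemma correlation_decomposition: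
  fixes A :: "nat \<Rightarrow> nat \<Rightarrow> real" and \<beta> :: "nat \<Rightarrow> real" and n p :: nat
  defines "S \<equiv> {j. j < p \<and> \<beta> j \<noteq> 0}" and "X \<equiv> normalize_cols n A"
  assumes nz: "\<And>m. m \<in> S \<Longrightarrow> col_norm n A m > 0" and j: "j < p"
  shows "tmat_vec n X (\<lambda>i. mat_vec p X \<beta> i + e i) j =
    \<beta> j + (\<Sum>m\<in>S - {j}. \<beta> m * ((\<Sum>i<n. X i j * A i m) / col_norm n A m)) + (\<Sum>i<n. X i j * e i)"
proof -
  have fS: "finite S" by (simp add: S_def)
  have "tmat_vec n X (\<lambda>i. mat_vec p X \<beta> i + e i) j =
      (\<Sum>i<n. \<Sum>m<p. X i j * (X i m * \<beta> m)) + (\<Sum>i<n. X i j * e i)"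
    by (simp add: tmat_vec_def mat_vec_def distrib_left sum.distrib sum_distrib_left)
  also have "(\<Sum>i<n. \<Sum>m<p. X i j * (X i m * \<beta> m)) = (\<Sum>m<p. \<Sum>i<n. X i j * (X i m * \<beta> m))"
    by (rule sum.swap)
  also have "\<dots> = (\<Sum>m<p. \<beta> m * (\<Sum>i<n. X i j * X i m))"
    by (simp add: sum_distrib_left mult_ac)
  also have "\<dots> = (\<Sum>m\<in>S. \<beta> m * (\<Sum>i<n. X i j * X i m))"
    by (rule sum.mono_neutral_right) (auto simp: S_def)
  also have "\<dots> = \<beta> j + (\<Sum>m\<in>S - {j}. \<beta> m * (\<Sum>i<n. X i j * X i m))"
  proof (cases "j \<in> S")
    case True
    have "(\<Sum>i<n. X i j * X i j) = (\<Sum>i<n. (A i j)\<^sup>2) / (col_norm n A j)\<^sup>2"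
      by (simp add: X_def normalize_cols_def power2_eq_square sum_divide_distrib)
    also have "(\<Sum>i<n. (A i j)\<^sup>2) = (col_norm n A j)\<^sup>2"
      by (simp add: col_norm_def sum_nonneg)
    finally have "(\<Sum>i<n. X i j * X i j) = 1" using nz[OF True] by simp
    then show ?thesis using sum.remove[OF fS True, of "\<lambda>m. \<beta> m * (\<Sum>i<n. X i j * X i m)"] by simp
  next
    case False
    then have "\<beta> j = 0" using j by (simp add: S_def)
    then show ?thesis using False by simp
  qed
  also have "(\<Sum>m\<in>S - {j}. \<beta> m * (\<Sum>i<n. X i j * X i m)) =
      (\<Sum>m\<in>S - {j}. \<beta> m * ((\<Sum>i<n. X i j * A i m) / col_norm n A m))"
    by (simp add: X_def normalize_cols_def sum_divide_distrib)
  finally show ?thesis .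
qed

text \<open>Indexing entries and noise by one sum type expresses their joint independence in a
  single assumption. All admissible \<open>d\<close> and all ways of breaking ties lie inside one
  event, so the guarantee is simultaneous.\<close>

theorem theorem2:
  fixes M :: "'a measure"
    and n p :: nat
    and V :: "nat \<Rightarrow> nat \<Rightarrow> 'a \<Rightarrow> real"
    and \<eta> :: "nat \<Rightarrow> 'a \<Rightarrow> real"
    and b s :: "nat \<Rightarrow> real"
    and \<beta> :: "nat \<Rightarrow> real"
    and \<sigma> :: real
  defines "S \<equiv> {j. j < p \<and> \<beta> j \<noteq> 0}"
  defines "k \<equiv> card S"
  defines "norm\<beta> \<equiv> sqrt (\<Sum>j<p. (\<beta> j)\<^sup>2)"
  defines "\<beta>min \<equiv> Min ((\<lambda>j. \<bar>\<beta> j\<bar>) ` S)"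
  defines "rstar \<equiv> Min ((\<lambda>j. s j / b j) ` S)"
  defines "L \<equiv> ln (real p)"
  assumes M: "prob_space M"
    and p2: "p \<ge> 2" and kn: "k < n" and \<sigma>pos: "\<sigma> > 0"
    and indep: "prob_space.indep_vars M (\<lambda>_. borel)
         (\<lambda>z. case z of Inl (i, j) \<Rightarrow> V i j | Inr i \<Rightarrow> \<eta> i)
         (({..<n} \<times> {..<p}) <+> {..<n})"
    and bpos: "\<And>j. j < p \<Longrightarrow> b j > 0"
    and spos: "\<And>j. j < p \<Longrightarrow> s j > 0"
    and subg: "\<And>i j. i < n \<Longrightarrow> j < p \<Longrightarrow> subG M (V i j) (b j)"
    and var: "\<And>i j. i < n \<Longrightarrow> j < p \<Longrightarrow> (\<integral>x. (V i j x)\<^sup>2 \<partial>M) = (s j)\<^sup>2"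
    and gauss: "\<And>i. i < n \<Longrightarrow> distributed M lborel (\<eta> i) (normal_density 0 \<sigma>)"
    and logp: "L \<le> real n / 16 * (rstar / 4) ^ 4"
    and beta_cond: "\<beta>min / norm\<beta> > 2 * sqrt (8 * L / real n) * (1 / rstar) + 4 * sqrt (\<sigma>\<^sup>2 * L) / norm\<beta>"
  shows "measure M {\<omega> \<in> space M.
           \<forall>d::nat. d \<le> p \<and>
              real d \<ge> real_of_int \<lceil>sqrt (real k) /
                 (\<beta>min / norm\<beta> - 2 * sqrt (8 * L / real n) * (1 / rstar) - 4 * sqrt (\<sigma>\<^sup>2 * L) / norm\<beta>)\<rceil>
           \<longrightarrow> (\<forall>Sh. alg1_output n p (normalize_cols n (\<lambda>i j. V i j \<omega>))
                       (\<lambda>i. mat_vec p (normalize_cols n (\<lambda>i j. V i j \<omega>)) \<beta> i + \<eta> i \<omega>) d Sh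
                     \<longrightarrow> S \<subseteq> Sh)}
         > 1 - 2 * (real k + 2) / real p"
proof (cases "S = {}")
  case True
  interpret prob_space M by (rule M)
  \<comment> \<open>With empty support the event is the whole space. The minima over
    \<open>S\<close> are meaningful only in the other case, hence the split.\<close>
  show ?thesis using True p2 by (simp add: prob_space)
next
  case False
  interpret prob_space M by (rule M)
  have fS: "finite S" and Sp: "S \<subseteq> {..<p}" by (auto simp: S_def)
  have k1: "k \<ge> 1" using False fS by (simp add: k_def Suc_le_eq card_gt_0_iff)
  have kp: "k \<le> p" using card_mono[OF _ Sp] by (simp add: k_def)
  have n: "n > 0" using kn by simp
  have L: "L > 0" unfolding L_def using p2 by simp
  have rj: "rstar \<le> s j / b j" if "j \<in> S" for j
    unfolding rstar_def using fS that by (intro Min_le) auto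
  have "rstar \<in> (\<lambda>j. s j / b j) ` S" unfolding rstar_def using fS False by (intro Min_in) auto
  then obtain j0 where j0: "j0 \<in> S" "rstar = s j0 / b j0" by auto
  have j0p: "j0 < p" using j0 Sp by auto
  have r: "rstar > 0" using j0 j0p spos bpos by simp
  \<comment> \<open>Compares variance and sub-Gaussian parameter for one entry of the column
    \<open>j0\<close> attaining the minimum; row 0 exists since \<open>n > 0\<close>.\<close>
  have r2: "rstar\<^sup>2 \<le> 8 / 3"
    using subG_power2_le[OF subg bpos, of 0 j0] var[of 0 j0] n j0p bpos[OF j0p]
    by (simp add: j0(2) power_divide pos_divide_le_eq)
  have m: "\<beta>min \<le> \<bar>\<beta> i\<bar>" if "i \<in> S" for i
    unfolding \<beta>min_def using fS that by (intro Min_le) auto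
  have "\<beta>min \<in> (\<lambda>j. \<bar>\<beta> j\<bar>) ` S" unfolding \<beta>min_def using fS False by (intro Min_in) auto
  then have mpos: "\<beta>min > 0" by (auto simp: S_def)
  have norm2: "norm\<beta>\<^sup>2 = (\<Sum>j<p. (\<beta> j)\<^sup>2)" by (simp add: norm\<beta>_def sum_nonneg)
  have "(\<Sum>j<p. (\<beta> j)\<^sup>2) > 0" using j0 j0p by (intro sum_pos2[of _ j0]) (auto simp: S_def)
  then have A: "norm\<beta> > 0" by (simp add: norm\<beta>_def)

  \<comment> \<open>Truncated fourth moments on the support\<close>
  define T where "T = 4 / 3 * L"
  define K where "K = 2 * (64 / 9 + 4 / 3 * T) * exp (- (3 / 8) * T)"
  \<comment> \<open>The truncated bound reads \<open>T b^2 s^2 + K b^4\<close>; by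
    \<open>b^2 <= s^2 / rstar^2\<close> both terms become multiples of \<open>b^2 s^2\<close>, with
    total factor \<open>Y\<close>.\<close>
  define Y where "Y = T + K / rstar\<^sup>2"
  define F where "F m = (b m)\<^sup>2 * (s m)\<^sup>2 * Y" for m
  define c where "c m = sqrt (7 / 8 * real n) * s m" for m
  have T: "T > 0" and K: "K > 0" using L by (auto simp: T_def K_def add_pos_nonneg)
  then have Y: "Y > 0" by (simp add: Y_def add_pos_nonneg)
  have kY: "real k * Y \<le> 3 / 2 * real n * L"
    using kurtosis_budget[OF p2 L_def[THEN meta_eq_to_obj_eq] kp kn r r2 logp]
    by (simp only: Y_def K_def T_def)
  have F4: "(\<integral>\<omega>. V i j \<omega> ^ 4 \<partial>M) \<le> F j" if "i < n" "j \<in> S" for i j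
  proof -
    have jp: "j < p" using that Sp by auto
    have "(\<integral>\<omega>. V i j \<omega> ^ 4 \<partial>M) \<le> T * (b j)\<^sup>2 * (s j)\<^sup>2 + K * ((b j)\<^sup>2 * (b j)\<^sup>2)"
      using subG_power4_le_truncated[OF subg[OF that(1) jp] bpos[OF jp], of T] T var[OF that(1) jp]
      by (simp add: K_def power2_eq_square power4_eq_xxxx mult_ac)
    also have "\<dots> \<le> T * (b j)\<^sup>2 * (s j)\<^sup>2 + K * ((b j)\<^sup>2 * ((s j)\<^sup>2 / rstar\<^sup>2))"
    proof -
      have "rstar * b j \<le> s j" using rj[OF that(2)] bpos[OF jp] by (simp add: field_simps)
      then have "(rstar * b j)\<^sup>2 \<le> (s j)\<^sup>2" using r bpos[OF jp] by (intro power_mono) auto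
      then have "(b j)\<^sup>2 \<le> (s j)\<^sup>2 / rstar\<^sup>2" using r by (simp add: field_simps power_mult_distrib)
      then show ?thesis using K by (intro add_left_mono mult_left_mono) auto
    qed
    also have "\<dots> = F j" by (simp add: F_def Y_def algebra_simps)
    finally show ?thesis .
  qed

  have Fpos: "F j > 0" if "j \<in> S" for j
  proof -
    have "j < p" using that Sp by auto
    then have "b j > 0" "s j > 0" using bpos spos by auto
    then show ?thesis using Y by (simp add: F_def)
  qed
  have measV[measurable]: "V i j \<in> borel_measurable M" if "i < n" "j < p" for i j
    using subg[OF that] by (simp add: subG_def)
  have meas\<eta>[measurable]: "\<eta> i \<in> borel_measurable M" if "i < n" for i
    using distributed_measurable[OF gauss[OF that]] by simp
  have indV: "indep_vars (\<lambda>_. borel) (\<lambda>z. V (fst z) (snd z)) ({..<n} \<times> {..<p})"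
    using indep_vars_reindex[OF indep, of Inl "{..<n} \<times> {..<p}"]
    by (auto simp: inj_on_def case_prod_beta)

  \<comment> \<open>Cross terms, noise terms and their thresholds\<close>
  define X where "X \<omega> = normalize_cols n (\<lambda>i j. V i j \<omega>)" for \<omega>
  \<comment> \<open>The floor \<open>c m\<close> is built in, so the moment bound for
    \<open>C j\<close> holds without conditioning; \<open>C j\<close> is the true cross term once
    all norms on \<open>S\<close> exceed their floors.\<close>
  define C where "C j \<omega> = (\<Sum>m\<in>S - {j}. \<beta> m * ((\<Sum>i<n. X \<omega> i j * V i m \<omega>) /
      max (col_norm n (\<lambda>i j. V i j \<omega>) m) (c m)))" for j \<omega>
  define E where "E j \<omega> = (\<Sum>i<n. X \<omega> i j * \<eta> i \<omega>)" for j \<omega>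
  define w where "w \<omega> = tmat_vec n (X \<omega>) (\<lambda>i. mat_vec p (X \<omega>) \<beta> i + \<eta> i \<omega>)" for \<omega>
  \<comment> \<open>\<open>t + t'\<close> is the error allowed for every correlation, split between
    cross term and noise.\<close>
  define t where "t = sqrt (8 * L / real n) / rstar * norm\<beta>"
  define t' where "t' = 2 * \<sigma> * sqrt L"
  have measX[measurable]: "(\<lambda>\<omega>. X \<omega> i j) \<in> borel_measurable M" if "i < n" "j < p" for i j
    unfolding X_def normalize_cols_def col_norm_def using that by measurable
  have measC[measurable]: "C j \<in> borel_measurable M" if "j < p" for j
  proof -
    have "(\<lambda>\<omega>. \<beta> m * ((\<Sum>i<n. X \<omega> i j * V i m \<omega>) / max (col_norm n (\<lambda>i j. V i j \<omega>) m) (c m)))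
        \<in> borel_measurable M" if "m \<in> S - {j}" for m
    proof -
      have "m < p" using that Sp by auto
      then show ?thesis unfolding col_norm_def using \<open>j < p\<close> by measurable
    qed
    then show ?thesis unfolding C_def[abs_def] by (rule borel_measurable_sum)
  qed
  have measE[measurable]: "E j \<in> borel_measurable M" if "j < p" for j
    unfolding E_def[abs_def] using that by measurable
  have measw[measurable]: "(\<lambda>\<omega>. w \<omega> j) \<in> borel_measurable M" if "j < p" for j
    unfolding w_def tmat_vec_def mat_vec_def using that by measurable

  \<comment> \<open>Tail bounds for cross terms, noise terms and column norms\<close>
  have e2L: "exp (- 2 * L) = 1 / (real p)\<^sup>2"
  proof -
    have "exp (- 2 * L) = 1 / (exp L)\<^sup>2"
      by (simp add: exp_minus inverse_eq_divide exp_double)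
    then show ?thesis using p2 by (simp add: L_def)
  qed
  have pC: "prob {\<omega> \<in> space M. \<bar>C j \<omega>\<bar> \<ge> t} \<le> 2 / (real p)\<^sup>2" if j: "j < p" for j
  proof -
    define l where "l = 2 / 3 * sqrt (8 * L * real n) * rstar / norm\<beta>"
    define G where "G = (\<Sum>m\<in>S - {j}. 4 / 7 * (l * \<beta> m)\<^sup>2 * (b m)\<^sup>2 / (real n * (s m)\<^sup>2)
      + \<bar>l * \<beta> m\<bar> * (5 / 9 * sqrt (F m) / (real n * (s m)\<^sup>2)))"
    have l: "l > 0" using L n r A by (simp add: l_def)
    have mgf: "(\<integral>\<^sup>+\<omega>. ennreal (exp (l' * C j \<omega>)) \<partial>M) \<le> ennreal (exp G)" if l': "\<bar>l'\<bar> = l" for l'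
    proof -
      have "l'\<^sup>2 = l\<^sup>2" "\<bar>l'\<bar> = \<bar>l\<bar>" using l' l by (auto simp: power2_eq_iff abs_if split: if_splits)
      then have "G = (\<Sum>m\<in>S - {j}. 4 / 7 * (l' * \<beta> m)\<^sup>2 * (b m)\<^sup>2 / (real n * (s m)\<^sup>2)
        + \<bar>l' * \<beta> m\<bar> * (5 / 9 * sqrt (F m) / (real n * (s m)\<^sup>2)))"
        by (simp add: G_def power_mult_distrib abs_mult)
      then show ?thesis
        unfolding C_def X_def c_def using Sp j bpos spos subg var F4 Fpos fS
        by (simp only:) (intro cross_term_mgf indep_vars_subset[OF indV] n; auto simp: subset_iff)
    qed
    have "prob {\<omega> \<in> space M. \<bar>C j \<omega>\<bar> \<ge> t} \<le> 2 * exp (G - l * t)"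
      using j by (intro prob_abs_ge_le_exp l mgf) auto
    also have "G - l * t \<le> - 2 * L"
    proof -
      have "\<bar>l\<bar> = l" using l by simp
      moreover have "(\<Sum>m\<in>S - {j}. (\<beta> m)\<^sup>2) \<le> norm\<beta>\<^sup>2"
        unfolding norm2 using Sp by (intro sum_mono2) auto
      moreover have "card (S - {j}) \<le> k" unfolding k_def by (simp add: card_Diff1_le fS)
      ultimately have "G - \<bar>l\<bar> * t \<le> - 2 * L"
        unfolding G_def F_def t_def using fS A n r L Y kY rj bpos spos Sp
        by (intro chernoff_exponent_le[where k = k]) (auto simp: l_def subset_iff)
      then show ?thesis using l by simp
    qed
    finally show ?thesis using e2L by simp
  qed
  have pE: "prob {\<omega> \<in> space M. \<bar>E j \<omega>\<bar> \<ge> t'} \<le> 2 / (real p)\<^sup>2" if j: "j < p" for j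
  proof -
    \<comment> \<open>Minimizes \<open>\<sigma>^2 l^2 / 2 - l t'\<close>, with minimum
      \<open>- 2 L\<close>.\<close>
    define l where "l = 2 * sqrt L / \<sigma>"
    have l: "l > 0" using L \<sigma>pos by (simp add: l_def)
    have mgf: "(\<integral>\<^sup>+\<omega>. ennreal (exp (l' * E j \<omega>)) \<partial>M) \<le> ennreal (exp (2 * L))" if l': "\<bar>l'\<bar> = l" for l'
    proof -
      have "l'\<^sup>2 = l\<^sup>2" using l' by (metis power2_abs)
      then have "\<sigma>\<^sup>2 * l'\<^sup>2 / 2 = 2 * L" using \<sigma>pos L by (simp add: l_def power_divide power_mult_distrib)
      moreover have "(\<integral>\<^sup>+\<omega>. ennreal (exp (l' * E j \<omega>)) \<partial>M) \<le> ennreal (exp (\<sigma>\<^sup>2 * l'\<^sup>2 / 2))"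
        unfolding E_def X_def using gaussian_mgf[OF gauss \<sigma>pos]
        by (intro noise_term_mgf[OF indep j]) auto
      ultimately show ?thesis by simp
    qed
    have "prob {\<omega> \<in> space M. \<bar>E j \<omega>\<bar> \<ge> t'} \<le> 2 * exp (2 * L - l * t')"
      using j by (intro prob_abs_ge_le_exp l mgf) auto
    also have "2 * L - l * t' = - 2 * L" using L \<sigma>pos by (simp add: l_def t'_def)
    finally show ?thesis using e2L by simp
  qed
  have pN: "prob {\<omega> \<in> space M. (\<Sum>i<n. (V i j \<omega>)\<^sup>2) \<le> 7 / 8 * real n * (s j)\<^sup>2} \<le> 1 / (real p)\<^sup>2"
    if j: "j \<in> S" for j
  proof -
    have jp: "j < p" using j Sp by auto
    have col: "indep_vars (\<lambda>_. borel) (\<lambda>i. V i j) {..<n}"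
      using indep_vars_reindex[OF indV, of "\<lambda>i. (i, j)" "{..<n}"] jp by (auto simp: inj_on_def)
    have "prob {\<omega> \<in> space M. (\<Sum>i<n. (V i j \<omega>)\<^sup>2) \<le> 7 / 8 * real n * (s j)\<^sup>2} \<le> exp (- real n * (s j / b j) ^ 4 / 2048)"
      using subg var bpos spos jp by (intro subG_norm_lower_tail col) auto
    also have "- real n * (s j / b j) ^ 4 / 2048 \<le> - 2 * L"
    proof -
      have "rstar ^ 4 \<le> (s j / b j) ^ 4" using rj[OF j] r by (intro power_mono) auto
      then have "real n * rstar ^ 4 \<le> real n * (s j / b j) ^ 4" by (intro mult_left_mono) auto
      \<comment> \<open>\<open>4096 = 16 * 4^4\<close> is twice the 2048 of the lower-tail exponent,
        which yields exactly \<open>- 2 L\<close>.\<close>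
      moreover have "4096 * L \<le> real n * rstar ^ 4" using logp by (simp add: power_divide field_simps)
      ultimately show ?thesis by simp
    qed
    finally show ?thesis using e2L by simp
  qed

  \<comment> \<open>Union bound over the exceptional events\<close>
  define Bad where "Bad = (\<Union>j<p. {\<omega> \<in> space M. \<bar>C j \<omega>\<bar> \<ge> t} \<union> {\<omega> \<in> space M. \<bar>E j \<omega>\<bar> \<ge> t'}) \<union>
      (\<Union>j\<in>S. {\<omega> \<in> space M. (\<Sum>i<n. (V i j \<omega>)\<^sup>2) \<le> 7 / 8 * real n * (s j)\<^sup>2})"
  have sC: "{\<omega> \<in> space M. \<bar>C j \<omega>\<bar> \<ge> t} \<in> sets M" "{\<omega> \<in> space M. \<bar>E j \<omega>\<bar> \<ge> t'} \<in> sets M" if "j < p" for j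
    using that by measurable
  have sN: "{\<omega> \<in> space M. (\<Sum>i<n. (V i j \<omega>)\<^sup>2) \<le> 7 / 8 * real n * (s j)\<^sup>2} \<in> sets M" if "j \<in> S" for j
  proof -
    have "j < p" using that Sp by auto
    then show ?thesis by measurable
  qed
  have sBad: "Bad \<in> sets M"
    unfolding Bad_def by (intro sets.Un sets.finite_UN sC sN fS finite_lessThan) simp_all
  have pBad: "prob Bad \<le> (4 * real p + real k) / (real p)\<^sup>2"
  proof -
    have "prob Bad \<le> prob (\<Union>j<p. {\<omega> \<in> space M. \<bar>C j \<omega>\<bar> \<ge> t} \<union> {\<omega> \<in> space M. \<bar>E j \<omega>\<bar> \<ge> t'}) +
      prob (\<Union>j\<in>S. {\<omega> \<in> space M. (\<Sum>i<n. (V i j \<omega>)\<^sup>2) \<le> 7 / 8 * real n * (s j)\<^sup>2})"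
      unfolding Bad_def by (intro measure_Un_le sets.Un sets.finite_UN sC sN fS finite_lessThan) simp_all
    also have "\<dots> \<le> (\<Sum>j<p. prob ({\<omega> \<in> space M. \<bar>C j \<omega>\<bar> \<ge> t} \<union> {\<omega> \<in> space M. \<bar>E j \<omega>\<bar> \<ge> t'})) +
      (\<Sum>j\<in>S. prob {\<omega> \<in> space M. (\<Sum>i<n. (V i j \<omega>)\<^sup>2) \<le> 7 / 8 * real n * (s j)\<^sup>2})"
    proof (intro add_mono finite_measure_subadditive_finite)
      show "(\<lambda>j. {\<omega> \<in> space M. \<bar>C j \<omega>\<bar> \<ge> t} \<union> {\<omega> \<in> space M. \<bar>E j \<omega>\<bar> \<ge> t'}) ` {..<p} \<subseteq> events"
        by (intro image_subsetI sets.Un sC) simp_all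
      show "(\<lambda>j. {\<omega> \<in> space M. (\<Sum>i<n. (V i j \<omega>)\<^sup>2) \<le> 7 / 8 * real n * (s j)\<^sup>2}) ` S \<subseteq> events"
        by (intro image_subsetI sN)
    qed (use fS in simp_all)
    also have "\<dots> \<le> (\<Sum>j<p. 4 / (real p)\<^sup>2) + (\<Sum>j\<in>S. 1 / (real p)\<^sup>2)"
    proof (intro add_mono sum_mono pN)
      fix j assume "j \<in> {..<p}"
      then have j: "j < p" by simp
      have "prob ({\<omega> \<in> space M. \<bar>C j \<omega>\<bar> \<ge> t} \<union> {\<omega> \<in> space M. \<bar>E j \<omega>\<bar> \<ge> t'}) \<le>
          prob {\<omega> \<in> space M. \<bar>C j \<omega>\<bar> \<ge> t} + prob {\<omega> \<in> space M. \<bar>E j \<omega>\<bar> \<ge> t'}"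
        using sC[OF j] by (intro measure_Un_le)
      also have "\<dots> \<le> 2 / (real p)\<^sup>2 + 2 / (real p)\<^sup>2" using pC[OF j] pE[OF j] by (rule add_mono)
      finally show "prob ({\<omega> \<in> space M. \<bar>C j \<omega>\<bar> \<ge> t} \<union> {\<omega> \<in> space M. \<bar>E j \<omega>\<bar> \<ge> t'}) \<le> 4 / (real p)\<^sup>2"
        by simp
    qed
    also have "\<dots> = (4 * real p + real k) / (real p)\<^sup>2" by (simp add: k_def add_divide_distrib)
    finally show ?thesis .
  qed

  \<comment> \<open>The success event: measurability and inclusion\<close>
  define thr where "thr = real_of_int \<lceil>sqrt (real k) /
      (\<beta>min / norm\<beta> - 2 * sqrt (8 * L / real n) * (1 / rstar) - 4 * sqrt (\<sigma>\<^sup>2 * L) / norm\<beta>)\<rceil>"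
  define Good where "Good = {\<omega> \<in> space M. \<forall>d::nat. d \<le> p \<and> real d \<ge> thr \<longrightarrow>
      (\<forall>Sh. alg1_output n p (X \<omega>) (\<lambda>i. mat_vec p (X \<omega>) \<beta> i + \<eta> i \<omega>) d Sh \<longrightarrow> S \<subseteq> Sh)}"
  have alg: "alg1_output n p (X \<omega>) (\<lambda>i. mat_vec p (X \<omega>) \<beta> i + \<eta> i \<omega>) d Sh \<longleftrightarrow>
      Sh \<subseteq> {..<p} \<and> card Sh = d \<and> (\<forall>i\<in>Sh. \<forall>j\<in>{..<p} - Sh. \<bar>w \<omega> i\<bar> \<ge> \<bar>w \<omega> j\<bar>)" for \<omega> d Sh
    by (simp add: alg1_output_def w_def Let_def)
  have sGood: "Good \<in> sets M"
  proof -
    \<comment> \<open>Failure means that one of the finitely many sets in \<open>Q\<close> satisfies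
      the ordering condition; \<open>d\<close> disappears because it equals
      \<open>card Sh\<close>.\<close>
    define Q where "Q = {Sh \<in> Pow {..<p}. \<not> S \<subseteq> Sh \<and> card Sh \<le> p \<and> real (card Sh) \<ge> thr}"
    have "{\<omega> \<in> space M. \<forall>i\<in>Sh. \<forall>j\<in>{..<p} - Sh. \<bar>w \<omega> j\<bar> \<le> \<bar>w \<omega> i\<bar>} \<in> sets M" if "Sh \<in> Q" for Sh
    proof -
      have Sh: "Sh \<subseteq> {..<p}" "finite Sh" using that finite_subset[of Sh "{..<p}"] by (auto simp: Q_def)
      have "{\<omega> \<in> space M. \<bar>w \<omega> j\<bar> \<le> \<bar>w \<omega> i\<bar>} \<in> sets M" if "i < p" "j < p" for i j
        using that by measurable
      then show ?thesis using Sh by (intro sets.sets_Collect_finite_All) auto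
    qed
    moreover have "finite Q" by (simp add: Q_def)
    ultimately have "space M - (\<Union>Sh\<in>Q. {\<omega> \<in> space M. \<forall>i\<in>Sh. \<forall>j\<in>{..<p} - Sh. \<bar>w \<omega> j\<bar> \<le> \<bar>w \<omega> i\<bar>}) \<in> sets M"
      by (intro sets.Diff sets.finite_UN) auto
    also have "space M - (\<Union>Sh\<in>Q. {\<omega> \<in> space M. \<forall>i\<in>Sh. \<forall>j\<in>{..<p} - Sh. \<bar>w \<omega> j\<bar> \<le> \<bar>w \<omega> i\<bar>}) = Good"
      unfolding Good_def alg Q_def by blast
    finally show ?thesis .
  qed
  have "space M - Bad \<subseteq> Good"
  proof
    fix \<omega> assume \<omega>: "\<omega> \<in> space M - Bad"
    have Ct: "\<bar>C j \<omega>\<bar> < t" and Et: "\<bar>E j \<omega>\<bar> < t'" if "j < p" for j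
      using \<omega> that by (auto simp: Bad_def not_le)
    have cn: "col_norm n (\<lambda>i j. V i j \<omega>) m > c m" if "m \<in> S" for m
    proof -
      have "(\<Sum>i<n. (V i m \<omega>)\<^sup>2) > 7 / 8 * real n * (s m)\<^sup>2" using \<omega> that by (auto simp: Bad_def not_le)
      moreover have "s m > 0" using spos that Sp by auto
      then have "c m = sqrt (7 / 8 * real n * (s m)\<^sup>2)"
        by (simp only: c_def real_sqrt_mult[of _ "(s m)\<^sup>2"] real_sqrt_abs abs_of_pos)
      ultimately show ?thesis by (simp add: col_norm_def)
    qed
    have c0: "c m \<ge> 0" if "m \<in> S" for m using spos[of m] that Sp by (auto simp: c_def subset_iff)
    have wC: "w \<omega> j = \<beta> j + C j \<omega> + E j \<omega>" if "j < p" for j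
    proof -
      have "C j \<omega> = (\<Sum>m\<in>S - {j}. \<beta> m * ((\<Sum>i<n. X \<omega> i j * V i m \<omega>) / col_norm n (\<lambda>i j. V i j \<omega>) m))"
        unfolding C_def using cn by (intro sum.cong) (simp_all add: max_absorb1 less_imp_le)
      moreover have "col_norm n (\<lambda>i j. V i j \<omega>) m > 0" if "m \<in> S" for m
        using cn[OF that] c0[OF that] by linarith
      ultimately show ?thesis
        using correlation_decomposition[of p \<beta> n "\<lambda>i j. V i j \<omega>" j "\<lambda>i. \<eta> i \<omega>"] that
        unfolding w_def E_def X_def S_def by simp
    qed
    have "S \<subseteq> Sh" if d: "real d \<ge> thr" and Sh: "Sh \<subseteq> {..<p}" "card Sh = d"
      "\<forall>i\<in>Sh. \<forall>j\<in>{..<p} - Sh. \<bar>w \<omega> i\<bar> \<ge> \<bar>w \<omega> j\<bar>" for d Sh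
      unfolding S_def
    proof (rule largest_entries_contain_support[where w = "w \<omega>" and e = "t + t'" and m = \<beta>min], fold S_def)
      show "\<bar>w \<omega> j - \<beta> j\<bar> \<le> t + t'" if "j < p" for j
        using wC[OF that] Ct[OF that] Et[OF that] by simp
      \<comment> \<open>Denominator of the threshold for \<open>d\<close>. Multiplied by
        \<open>norm\<beta>\<close> it is the margin \<open>\<beta>min - 2 (t + t')\<close> of the
        deterministic selection lemma.\<close>
      define gap where "gap = \<beta>min / norm\<beta> - 2 * sqrt (8 * L / real n) * (1 / rstar) - 4 * sqrt (\<sigma>\<^sup>2 * L) / norm\<beta>"
      have gap: "gap > 0" using beta_cond by (simp add: gap_def)
      have "sqrt (real k) / gap \<le> real d" using d unfolding thr_def gap_def by linarith
      then have "sqrt (real k) \<le> real d * gap" using gap by (simp add: pos_divide_le_eq)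
      then have "sqrt (real k) * norm\<beta> \<le> real d * (gap * norm\<beta>)"
        using A by (simp add: mult_right_mono mult.assoc[symmetric])
      also have "gap * norm\<beta> = \<beta>min - 2 * (t + t')"
        using A \<sigma>pos by (simp add: gap_def t_def t'_def real_sqrt_mult algebra_simps)
      finally show "sqrt (real (card S)) * sqrt (\<Sum>j<p. (\<beta> j)\<^sup>2) \<le> real (card Sh) * (\<beta>min - 2 * (t + t'))"
        using Sh(2) by (simp add: k_def norm\<beta>_def)
    qed (use m mpos Sh in auto)
    then show "\<omega> \<in> Good" using \<omega> by (auto simp: Good_def alg)
  qed
  then have "prob (space M - Bad) \<le> prob Good" using sGood by (intro finite_measure_mono)
  then have "1 - prob Bad \<le> prob Good" using prob_compl[OF sBad] by simp
  \<comment> \<open>Strict because \<open>k < 2 k p\<close>, where \<open>k >= 1\<close>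
    enters.\<close>
  moreover have "(4 * real p + real k) / (real p)\<^sup>2 < 2 * (real k + 2) / real p"
  proof -
    have "real k * 1 \<le> real k * real p" using p2 by (intro mult_left_mono) auto
    then have "4 * real p + real k < 2 * (real k + 2) * real p" using k1 p2 by (simp add: algebra_simps)
    then have "(4 * real p + real k) / (real p)\<^sup>2 < (2 * (real k + 2) * real p) / (real p)\<^sup>2"
      using p2 by (intro divide_strict_right_mono) auto
    then show ?thesis using p2 by (simp add: power2_eq_square split: if_splits)
  qed
  ultimately have "1 - 2 * (real k + 2) / real p < prob Good" using pBad by linarith
  then show ?thesis unfolding Good_def thr_def X_def .
qed

end
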